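(* Let $n$ be an odd integer with $3\leq n<17$. For a planar lattice $L$, the following are equivalent: (i) $L$ contains an equilateral $n$-gon; (ii) $L$ contains a convex equilateral $k$-gon for every integer $k\geq n$; (iii) $L$ is similar to a planar integral lattice $L'$ such that $\nu(L')\equiv 3\pmod 4$ and the largest prime factor $p$ of $\nu(L')$ satisfies $p\leq n$.
   Context: A planar lattice is a set $L[\mathbf{a},\mathbf{b}]=\{m\mathbf{a}+n\mathbf{b}\mid m,n\in\mathbb{Z}\}\subset\mathbb{R}^2$ for linearly independent vectors $\mathbf{a},\mathbf{b}\in\mathbb{R}^2$. It is integral if $\mathbf{x}\cdot\mathbf{y}\in\mathbb{Z}$ for all $\mathbf{x},\mathbf{y}\in L$. A lattice $L$ is similar to $L'$ if there is $\lambda>0$ such that $\lambda L=\{\lambda\mathbf{x}\mid \mathbf{x}\in L\}$ is isometric to $L'$. $D(L)=|\det(\mathbf{a},\mathbf{b})|$ is the area of a fundamental parallelogram (independent of the choice of generators); for integral $L$, $D(L)^2$ is a positive integer, and $\nu(L)$ denotes its square-free part, i.e. the square-free positive integer with $D(L)^2=k^2\nu(L)$ for some integer $k$. An equilateral $n$-gon is a polygon with $n$ vertices whose sides all have equal length; a set $S$ contains a polygon if every vertex of the polygon lies in $S$. *)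

theory Defs
  imports "HOL-Analysis.Analysis" "HOL-Computational_Algebra.Squarefree"
    "HOL-Number_Theory.Cong"
begin

definition lattice_gen :: "real^2 \<Rightarrow> real^2 \<Rightarrow> (real^2) set" where
  "lattice_gen a b = {of_int m *\<^sub>R a + of_int n *\<^sub>R b | m n. True}"

(* The condition a ~= b is needed because {a, b} is a set. *)
definition lattice_basis :: "real^2 \<Rightarrow> real^2 \<Rightarrow> (real^2) set \<Rightarrow> bool" where
  "lattice_basis a b L \<longleftrightarrow> a \<noteq> b \<and> independent {a, b} \<and> L = lattice_gen a b"

definition planar_lattice :: "(real^2) set \<Rightarrow> bool" where
  "planar_lattice L \<longleftrightarrow> (\<exists>a b. lattice_basis a b L)"

definition integral_lattice :: "(real^2) set \<Rightarrow> bool" where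
  "integral_lattice L \<longleftrightarrow> (\<forall>x\<in>L. \<forall>y\<in>L. x \<bullet> y \<in> \<int>)"

definition isometric_sets :: "'a::metric_space set \<Rightarrow> 'b::metric_space set \<Rightarrow> bool" where
  "isometric_sets S T \<longleftrightarrow>
     (\<exists>f. f ` S = T \<and> (\<forall>x\<in>S. \<forall>y\<in>S. dist (f x) (f y) = dist x y))"

definition similar_lattices :: "(real^2) set \<Rightarrow> (real^2) set \<Rightarrow> bool" where
  "similar_lattices L L' \<longleftrightarrow> (\<exists>c>0. isometric_sets ((\<lambda>x. c *\<^sub>R x) ` L) L')"

(* Independence of the chosen basis is lattice_area_eq below. *)
definition lattice_area :: "(real^2) set \<Rightarrow> real" where
  "lattice_area L =
     (THE d. \<exists>a b. lattice_basis a b L \<and> d = \<bar>det (vector [a, b] :: real^2^2)\<bar>)"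

(* Meaningful when lattice_area L ^ 2 is a positive integer, as for integral L;
   see lattice_nu_unique. Positivity is implied, since 0 is not square-free. *)
definition lattice_nu :: "(real^2) set \<Rightarrow> nat" where
  "lattice_nu L =
     (THE v. squarefree v \<and> (\<exists>k::int. (lattice_area L)\<^sup>2 = (of_int k)\<^sup>2 * of_nat v))"

(* A polygon is given by the cyclic list of its vertices. *)
definition polygon_side :: "(real^2) list \<Rightarrow> nat \<Rightarrow> (real^2) set" where
  "polygon_side vs i = closed_segment (vs ! i) (vs ! (Suc i mod length vs))"

(* Polygons are simple, and every vertex is a genuine corner (no straight angles).
   Non-collinearity already makes adjacent sides meet only in their common vertex. *)
definition polygon :: "(real^2) list \<Rightarrow> bool" where
  "polygon vs \<longleftrightarrow>
     (let n = length vs in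
       3 \<le> n \<and> distinct vs \<and>
       (\<forall>i<n. \<not> collinear {vs ! i, vs ! (Suc i mod n), vs ! (Suc (Suc i) mod n)}) \<and>
       (\<forall>i<n. \<forall>j<n. i \<noteq> j \<and> j \<noteq> Suc i mod n \<and> i \<noteq> Suc j mod n \<longrightarrow>
          polygon_side vs i \<inter> polygon_side vs j = {}))"

definition polygon_boundary :: "(real^2) list \<Rightarrow> (real^2) set" where
  "polygon_boundary vs = (\<Union>i<length vs. polygon_side vs i)"

definition polygon_region :: "(real^2) list \<Rightarrow> (real^2) set" where
  "polygon_region vs = polygon_boundary vs \<union> inside (polygon_boundary vs)"

definition convex_polygon :: "(real^2) list \<Rightarrow> bool" where
  "convex_polygon vs \<longleftrightarrow> polygon vs \<and> convex (polygon_region vs)"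

definition equilateral :: "(real^2) list \<Rightarrow> bool" where
  "equilateral vs \<longleftrightarrow>
     (\<exists>s. \<forall>i<length vs. dist (vs ! i) (vs ! (Suc i mod length vs)) = s)"

definition contains_equilateral_gon :: "(real^2) set \<Rightarrow> nat \<Rightarrow> bool" where
  "contains_equilateral_gon S n \<longleftrightarrow>
     (\<exists>vs. length vs = n \<and> polygon vs \<and> equilateral vs \<and> set vs \<subseteq> S)"

definition contains_convex_equilateral_gon :: "(real^2) set \<Rightarrow> nat \<Rightarrow> bool" where
  "contains_convex_equilateral_gon S n \<longleftrightarrow>
     (\<exists>vs. length vs = n \<and> convex_polygon vs \<and> equilateral vs \<and> set vs \<subseteq> S)"

lemma det_vector_2: "det (vector [a, b] :: real^2^2) = a$1 * b$2 - a$2 * b$1"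
  by (simp add: det_2)

lemma lattice_basis_det_nonzero:
  assumes "lattice_basis a b L"
  shows "det (vector [a, b] :: real^2^2) \<noteq> 0"
proof
  assume "det (vector [a, b] :: real^2^2) = 0"
  then have d: "a$1 * b$2 = a$2 * b$1" by (simp add: det_vector_2)
  have ind: "independent {a, b}" and ne: "a \<noteq> b"
    using assms by (auto simp: lattice_basis_def)
  have *: "u = 0 \<and> v = 0" if "u *\<^sub>R a + v *\<^sub>R b = 0" for u v
  proof -
    define w where "w = (\<lambda>x. if x = a then u else v)"
    have s: "(\<Sum>x\<in>{a, b}. w x *\<^sub>R x) = 0" using ne that by (simp add: w_def)
    have "w a = 0" "w b = 0"
      using independentD[OF ind _ subset_refl s] by auto
    then show ?thesis using ne by (simp add: w_def)
  qed
  have "b$2 *\<^sub>R a + (- a$2) *\<^sub>R b = 0" "b$1 *\<^sub>R a + (- a$1) *\<^sub>R b = 0"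
    using d by (auto simp: vec_eq_iff forall_2 mult.commute)
  from *[OF this(1)] *[OF this(2)] have "a = 0" by (auto simp: vec_eq_iff forall_2)
  then show False using ind dependent_zero by blast
qed

lemma lattice_basis_abs_det_le:
  assumes "lattice_basis a b L" "lattice_basis c d L"
  shows "\<bar>det (vector [a, b] :: real^2^2)\<bar> \<le> \<bar>det (vector [c, d] :: real^2^2)\<bar>"
proof -
  have "c = of_int 1 *\<^sub>R c + of_int 0 *\<^sub>R d" "d = of_int 0 *\<^sub>R c + of_int 1 *\<^sub>R d"
    by simp_all
  then have "c \<in> lattice_gen c d" "d \<in> lattice_gen c d"
    unfolding lattice_gen_def by blast+
  then have "c \<in> lattice_gen a b" "d \<in> lattice_gen a b"
    using assms by (simp_all add: lattice_basis_def)
  then obtain p q r s :: int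
    where cd: "c = of_int p *\<^sub>R a + of_int q *\<^sub>R b" "d = of_int r *\<^sub>R a + of_int s *\<^sub>R b"
    by (auto simp: lattice_gen_def)
  have eq: "det (vector [c, d] :: real^2^2)
      = of_int (p * s - q * r) * det (vector [a, b] :: real^2^2)"
    by (simp add: det_vector_2 cd algebra_simps)
  then have "p * s - q * r \<noteq> 0"
    using lattice_basis_det_nonzero[OF assms(2)] by (metis mult_zero_left of_int_0)
  then have "1 \<le> \<bar>of_int (p * s - q * r) :: real\<bar>"
    by linarith
  then show ?thesis
    unfolding eq abs_mult using mult_right_mono by fastforce
qed

lemma lattice_area_eq:
  assumes "lattice_basis a b L"
  shows "lattice_area L = \<bar>det (vector [a, b] :: real^2^2)\<bar>"
  unfolding lattice_area_def
  using assms by (intro the_equality) (auto intro!: antisym lattice_basis_abs_det_le)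

lemma lattice_area_pos: "planar_lattice L \<Longrightarrow> 0 < lattice_area L"
  unfolding planar_lattice_def
  using lattice_area_eq lattice_basis_det_nonzero by fastforce

lemma lattice_area_square_Ints:
  assumes "planar_lattice L" "integral_lattice L"
  shows "(lattice_area L)\<^sup>2 \<in> \<int>"
proof -
  obtain a b where ab: "lattice_basis a b L"
    using assms(1) by (auto simp: planar_lattice_def)
  have "a = of_int 1 *\<^sub>R a + of_int 0 *\<^sub>R b" "b = of_int 0 *\<^sub>R a + of_int 1 *\<^sub>R b"
    by simp_all
  then have "a \<in> lattice_gen a b" "b \<in> lattice_gen a b"
    unfolding lattice_gen_def by blast+
  then have "a \<in> L" "b \<in> L"
    using ab by (simp_all add: lattice_basis_def)
  then have "a \<bullet> a \<in> \<int>" "b \<bullet> b \<in> \<int>" "a \<bullet> b \<in> \<int>"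
    using assms(2) by (auto simp: integral_lattice_def)
  moreover have "(lattice_area L)\<^sup>2 = (a \<bullet> a) * (b \<bullet> b) - (a \<bullet> b)\<^sup>2"
    by (simp add: lattice_area_eq[OF ab] det_vector_2 inner_vec_def sum_2
        power2_eq_square algebra_simps)
  ultimately show ?thesis by simp
qed

lemma lattice_nu_unique:
  assumes "planar_lattice L" "integral_lattice L"
  shows "\<exists>!v::nat. squarefree v \<and> (\<exists>k::int. (lattice_area L)\<^sup>2 = (of_int k)\<^sup>2 * of_nat v)"
proof -
  obtain z :: int where z: "(lattice_area L)\<^sup>2 = of_int z"
    using lattice_area_square_Ints[OF assms] by (auto elim: Ints_cases)
  have zpos: "0 < z"
    using lattice_area_pos[OF assms(1)] z by (metis of_int_0_less_iff zero_less_power)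
  define m where "m = nat z"
  have m: "(lattice_area L)\<^sup>2 = of_nat m" and m0: "m \<noteq> 0"
    using z zpos by (auto simp: m_def)
  have iff: "(\<exists>k::int. (lattice_area L)\<^sup>2 = (of_int k)\<^sup>2 * of_nat v) \<longleftrightarrow> (\<exists>k::nat. m = k\<^sup>2 * v)"
    for v :: nat
  proof
    assume "\<exists>k::int. (lattice_area L)\<^sup>2 = (of_int k)\<^sup>2 * of_nat v"
    then obtain k :: int where "real m = (of_int k)\<^sup>2 * real v" using m by auto
    then have "real m = real ((nat \<bar>k\<bar>)\<^sup>2 * v)" by simp
    then show "\<exists>k::nat. m = k\<^sup>2 * v" unfolding of_nat_eq_iff by blast
  next
    assume "\<exists>k::nat. m = k\<^sup>2 * v"
    then obtain k where "m = k\<^sup>2 * v" by blast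
    then have "(lattice_area L)\<^sup>2 = (of_int (int k))\<^sup>2 * of_nat v" using m by simp
    then show "\<exists>k::int. (lattice_area L)\<^sup>2 = (of_int k)\<^sup>2 * of_nat v" by blast
  qed
  show ?thesis unfolding iff
  proof (rule ex1I[of _ "squarefree_part m"])
    show "squarefree (squarefree_part m) \<and> (\<exists>k::nat. m = k\<^sup>2 * squarefree_part m)"
      using squarefree_decompose[of m] by (auto simp: mult.commute)
  next
    fix v :: nat
    assume v: "squarefree v \<and> (\<exists>k::nat. m = k\<^sup>2 * v)"
    then obtain k where k: "m = k\<^sup>2 * v" by blast
    show "v = squarefree_part m"
    proof (rule multiplicity_eq_nat)
      show "0 < v" "0 < squarefree_part m" using k m0 by (auto intro: gr0I)
      fix p :: nat assume p: "prime p"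
      have "k \<noteq> 0" "v \<noteq> 0" using k m0 by auto
      then have "multiplicity p m = 2 * multiplicity p k + multiplicity p v"
        using k p by (simp add: prime_elem_multiplicity_mult_distrib
            prime_elem_multiplicity_power_distrib)
      moreover have "multiplicity p v \<le> 1"
        using v p \<open>v \<noteq> 0\<close> by (simp add: squarefree_factorial_semiring'')
      ultimately show "multiplicity p v = multiplicity p (squarefree_part m)"
        using p by (simp add: prime_multiplicity_squarefree_part)
    qed
  qed
qed

end

(* Dividing the sides of an equilateral n-gon by one of them gives n elements of norm 1 in
   Q(sqrt(-nu)) with sum 0. For n odd, reducing a primitive integral solution of
   x_i^2 + nu y_i^2 = N, sum x_i = sum y_i = 0 modulo 4 and modulo the primes p dividing nu forces
   nu = 3 (mod 4) and p <= n. Conversely, only 16 square-free nu = 3 (mod 4) have all prime factors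
   below 17, and each one has an explicit zero-sum set of norm-1 elements whose size is its largest prime factor.
   Adding pairs w, -w enlarges such a set, and sorting its elements by argument turns it into the
   sides of a convex polygon. *)
theory Submission
  imports Defs
begin

section \<open>Convex polygons from vectors with zero sum\<close>

text \<open>Oddness of n is what brings in arithmetic: an odd number of vectors from
  \<open>{v, - v, w, - w}\<close> with \<open>v\<close>, \<open>w\<close> independent cannot sum to
  0, so the sides have at least three pairwise non-parallel directions. Three such vectors of equal
  length fix the Gram matrix up to a rational factor, which is why the lattice is similar to an
  integral one at all. The field appears on completing the square: A times the form A m^2 + 2 B m l
  + C l^2 is (A m + B l)^2 + \<nu> (\<kappa> l)^2. Zero-sum sets, and not families with repetition,
  are needed for the converse: distinct vectors of equal length have distinct arguments, so no two
  consecutive sides of the sorted polygon continue each other in a straight line. The bound 17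
  serves to make the list of \<nu> finite. Of the primes 3, 5, 7, 11, 13 exactly 3, 7, 11 are 3
  modulo 4, so \<nu> has an odd number of factors among these three: 4 choices, times 4 for the
  subset of {5, 13}.\<close>

definition cross2 :: "real^2 \<Rightarrow> real^2 \<Rightarrow> real" where
  "cross2 a b = a$1 * b$2 - a$2 * b$1"

lemma cross2_simps [simp]:
  "cross2 a 0 = 0" "cross2 0 a = 0" "cross2 a a = 0"
  by (simp_all add: cross2_def)

lemma cross2_linear:
  "cross2 a (b + c) = cross2 a b + cross2 a c" "cross2 a (b - c) = cross2 a b - cross2 a c"
  "cross2 a (t *\<^sub>R b) = t * cross2 a b"
  by (simp_all add: cross2_def algebra_simps)

lemma cross2_sum: "cross2 a (sum f S) = (\<Sum>x\<in>S. cross2 a (f x))"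
  by (induction S rule: infinite_finite_induct) (simp_all add: cross2_linear)

lemma cross2_sum_left: "cross2 (sum f S) a = (\<Sum>x\<in>S. cross2 (f x) a)"
  by (induction S rule: infinite_finite_induct) (simp_all add: cross2_def algebra_simps)

lemma continuous_on_cross2 [continuous_intros]:
  "continuous_on S f \<Longrightarrow> continuous_on S (\<lambda>x. cross2 a (f x))"
  unfolding cross2_def by (intro continuous_intros)

lemma cross2_eq_0_imp_parallel:
  assumes "cross2 a b = 0" "a \<noteq> 0"
  obtains t where "b = t *\<^sub>R a"
proof
  have "(a$1)\<^sup>2 + (a$2)\<^sup>2 \<noteq> 0"
    using assms(2) by (auto simp: vec_eq_iff forall_2 sum_power2_eq_zero_iff)
  then show "b = ((a \<bullet> b) / (a \<bullet> a)) *\<^sub>R a"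
    using assms(1)
    by (simp add: vec_eq_iff forall_2 cross2_def inner_vec_def sum_2 field_simps power2_eq_square)
qed

text \<open>Angles are indexed by all naturals and gain 2 pi after \<open>k\<close> steps. Cyclic
  statements then live on windows \<open>{i..<i+k}\<close> starting at any side, and modular indices
  appear only at the interface with lists.\<close>

locale turning_vectors =
  fixes k :: nat and r :: real and \<theta> :: "nat \<Rightarrow> real"
  assumes k3: "3 \<le> k" and r0: "0 < r" and mono: "strict_mono \<theta>"
    and period: "\<theta> (i + k) = \<theta> i + 2 * pi"
    and closed: "(\<Sum>i<k. r *\<^sub>R (vector [cos (\<theta> i), sin (\<theta> i)] :: real^2)) = 0"
begin

definition side :: "nat \<Rightarrow> real^2" where
  "side i = r *\<^sub>R vector [cos (\<theta> i), sin (\<theta> i)]"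

definition vert :: "nat \<Rightarrow> real^2" where
  "vert i = (\<Sum>l<i. side l)"

lemma side_period: "side (i + k) = side i"
  by (simp add: side_def period)

lemma sum_side: "(\<Sum>l\<in>{i..<i+k}. side l) = 0"
proof (induction i)
  case 0
  then show ?case using closed by (simp add: side_def lessThan_atLeast0)
next
  case (Suc i)
  have "(\<Sum>l\<in>{Suc i..<Suc i+k}. side l) = (\<Sum>l\<in>{Suc i..<i+k}. side l) + side (i + k)"
    using k3 by simp
  moreover have "(\<Sum>l\<in>{i..<i+k}. side l) = side i + (\<Sum>l\<in>{Suc i..<i+k}. side l)"
    using k3 by (simp add: sum.atLeast_Suc_lessThan)
  ultimately show ?case using Suc k3 by (simp add: side_period add.commute)
qed

lemma vert_diff: "i \<le> j \<Longrightarrow> vert j - vert i = (\<Sum>l\<in>{i..<j}. side l)"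
  unfolding vert_def lessThan_atLeast0 by (simp add: sum_diff_nat_ivl)

lemma vert_period: "vert (i + k) = vert i"
  using vert_diff[of i "i + k"] sum_side[of i] by simp

lemma vert_Suc: "vert (Suc i) = vert i + side i"
  by (simp add: vert_def)

lemma period_mod:
  shows side_mod: "side (i mod k) = side i" and vert_mod: "vert (i mod k) = vert i"
proof -
  have "side (j + m * k) = side j \<and> vert (j + m * k) = vert j" for j m
  proof (induction m)
    case (Suc m)
    have "j + Suc m * k = (j + m * k) + k" by simp
    then show ?case using Suc side_period vert_period by metis
  qed simp
  from this[of "i mod k" "i div k"] show "side (i mod k) = side i" "vert (i mod k) = vert i"
    by simp_all
qed

lemma cross2_side: "cross2 (side i) (side j) = r\<^sup>2 * sin (\<theta> j - \<theta> i)"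
  by (simp add: cross2_def side_def sin_diff power2_eq_square algebra_simps)

lemma norm_side: "norm (side i) = r"
proof -
  have "(r * cos x)\<^sup>2 + (r * sin x)\<^sup>2 = r\<^sup>2" for x
    by (simp add: power_mult_distrib flip: distrib_left)
  then show ?thesis using r0 by (simp add: side_def norm_vec_def L2_set_def sum_2)
qed

lemma angle_less: "i < j \<Longrightarrow> \<theta> i < \<theta> j"
  using mono by (simp add: strict_mono_def)

lemma angle_less_period: "j < i + k \<Longrightarrow> \<theta> j < \<theta> i + 2 * pi"
  using angle_less[of j "i + k"] period by simp

text \<open>The closing relation crossed with \<open>side i\<close>: over a full turn the components
  perpendicular to \<open>side i\<close> cancel.\<close>

lemma sum_sin: "(\<Sum>l\<in>{i..<i+k}. sin (\<theta> l - \<theta> i)) = 0"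
proof -
  have "r\<^sup>2 * (\<Sum>l\<in>{i..<i+k}. sin (\<theta> l - \<theta> i)) = 0"
    using arg_cong[OF sum_side[of i], of "cross2 (side i)"]
    by (simp add: cross2_sum cross2_side sum_distrib_left)
  then show ?thesis using r0 by simp
qed

text \<open>After a gap of at least pi, all remaining directions of the window would point weakly to
  the right of \<open>side i\<close>, so the sines in \<open>sum_sin\<close> could not
  cancel.\<close>

lemma angle_gap: "\<theta> (Suc i) - \<theta> i < pi"
proof (rule ccontr)
  assume "\<not> ?thesis"
  then have ge: "pi \<le> \<theta> (Suc i) - \<theta> i" by simp
  \<comment> \<open>For a gap of exactly pi the sine at \<open>Suc i\<close> vanishes; strictness
    has to come from \<open>Suc (Suc i)\<close>, which is inside the window because
    \<open>3 \<le> k\<close>.\<close>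
  have "\<theta> (Suc i) < \<theta> (Suc (Suc i))" by (simp add: angle_less)
  moreover have lt: "\<theta> l - \<theta> i < 2 * pi" if "l < i + k" for l
    using angle_less_period[OF that] by simp
  ultimately have s2: "sin (\<theta> (Suc (Suc i)) - \<theta> i) < 0"
    using ge k3 by (intro sin_lt_zero) auto
  have nonpos: "sin (\<theta> l - \<theta> i) \<le> 0" if "l \<in> {i..<i+k}" for l
  proof (cases "l \<le> i")
    case False
    then have "\<theta> (Suc i) \<le> \<theta> l"
      using mono by (simp add: strict_mono_less_eq)
    then show ?thesis using ge lt[of l] that by (intro sin_le_zero) auto
  qed (use that in auto)
  have "(\<Sum>l\<in>{i..<i+k}. sin (\<theta> l - \<theta> i)) < (\<Sum>l\<in>{i..<i+k}. 0)"
    using nonpos s2 k3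
    by (intro sum_strict_mono_ex1) (auto intro!: bexI[of _ "Suc (Suc i)"])
  then show False using sum_sin[of i] by simp
qed

lemma sin_gap: "0 < sin (\<theta> (Suc i) - \<theta> i)"
  using angle_gap[of i] angle_less[of i "Suc i"] by (intro sin_gt_zero) auto

lemma cross2_adjacent: "0 < cross2 (side i) (side (Suc i))"
  using sin_gap[of i] r0 by (simp add: cross2_side)

text \<open>Seen from side \<open>i\<close>, the partial sums first rise and then fall back to \<open>0\<close>,
  because the sine changes sign only once within a turn.\<close>
lemma cross2_vert:
  assumes "i \<le> j" "j \<le> i + k"
  shows "0 \<le> cross2 (side i) (vert j - vert i)"
    and "Suc i < j \<Longrightarrow> j < i + k \<Longrightarrow> 0 < cross2 (side i) (vert j - vert i)"
proof -
  define S where "S = (\<Sum>l\<in>{i..<j}. sin (\<theta> l - \<theta> i))"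
  have eq: "cross2 (side i) (vert j - vert i) = r\<^sup>2 * S"
    by (simp add: vert_diff assms cross2_sum cross2_side sum_distrib_left S_def)
  have "0 \<le> S \<and> (Suc i < j \<and> j < i + k \<longrightarrow> 0 < S)"
  proof (cases "\<theta> (j - 1) - \<theta> i \<le> pi")
    case True
    have nn: "0 \<le> sin (\<theta> l - \<theta> i)" if "l \<in> {i..<j}" for l
    proof -
      have "\<theta> i \<le> \<theta> l" "\<theta> l \<le> \<theta> (j - 1)"
        using that mono by (auto simp: strict_mono_less_eq)
      then show ?thesis using True by (intro sin_ge_zero) auto
    qed
    have "0 < S" if "Suc i < j"
      unfolding S_def using nn sin_gap[of i] that
      by (intro sum_pos2[of _ "Suc i"]) auto
    then show ?thesis using nn by (auto simp: S_def intro!: sum_nonneg)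
  next
    case False
    have "S + (\<Sum>l\<in>{j..<i+k}. sin (\<theta> l - \<theta> i)) = 0"
      using sum_sin[of i] sum.atLeastLessThan_concat[OF assms, of "\<lambda>l. sin (\<theta> l - \<theta> i)"]
      by (simp add: S_def)
    then have S: "S = (\<Sum>l\<in>{j..<i+k}. - sin (\<theta> l - \<theta> i))"
      by (simp add: sum_negf)
    have neg: "0 < - sin (\<theta> l - \<theta> i)" if "l \<in> {j..<i+k}" for l
    proof -
      have "\<theta> (j - 1) \<le> \<theta> l" using that mono by (auto simp: strict_mono_less_eq)
      moreover have "\<theta> l < \<theta> i + 2 * pi" using that by (intro angle_less_period) auto
      ultimately have "sin (\<theta> l - \<theta> i) < 0" using False by (intro sin_lt_zero) auto
      then show ?thesis by simp
    qed
    then have "0 \<le> S" unfolding S by (intro sum_nonneg) (simp add: less_imp_le)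
    moreover have "0 < S" if "j < i + k"
      unfolding S using neg that by (intro sum_pos) auto
    ultimately show ?thesis by simp
  qed
  then show "0 \<le> cross2 (side i) (vert j - vert i)"
    and "Suc i < j \<Longrightarrow> j < i + k \<Longrightarrow> 0 < cross2 (side i) (vert j - vert i)"
    using r0 by (auto simp: eq)
qed

text \<open>The candidate for the polygonal region. Since the region is defined through
  \<open>inside\<close> of the boundary, the plan is to recognise the boundary as the frontier of
  this bounded convex set. Quantifying over all \<open>i\<close> makes every cyclic shift available;
  \<open>halfplanes_finite\<close> gives back the finite intersection needed for openness.\<close>

definition halfplanes :: "(real^2) set" where
  "halfplanes = {x. \<forall>i. 0 \<le> cross2 (side i) (x - vert i)}"

lemma vert_in_halfplanes: "vert j \<in> halfplanes"
proof -
  have "0 \<le> cross2 (side i) (vert j - vert i)" for i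
  proof -
    define i' where "i' = i mod k"
    \<comment> \<open>Adding a period where necessary moves the second index into the window
      starting at \<open>i'\<close>, where \<open>cross2_vert\<close> applies.\<close>
    define j' where "j' = (if i' \<le> j mod k then j mod k else j mod k + k)"
    have "i' < k" "j mod k < k" using k3 by (simp_all add: i'_def)
    then have "i' \<le> j'" "j' \<le> i' + k" unfolding j'_def by (auto simp del: mod_less_divisor)
    then have "0 \<le> cross2 (side i') (vert j' - vert i')" by (rule cross2_vert)
    moreover have "vert j' = vert j" by (simp add: j'_def vert_period vert_mod)
    ultimately show ?thesis by (simp add: i'_def period_mod)
  qed
  then show ?thesis by (simp add: halfplanes_def)
qed

lemma convex_halfplanes: "convex halfplanes"
proof (rule convexI)
  fix x y :: "real^2" and u v :: real
  assume xy: "x \<in> halfplanes" "y \<in> halfplanes" and uv: "0 \<le> u" "0 \<le> v" "u + v = 1"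
  have "0 \<le> cross2 (side i) (u *\<^sub>R x + v *\<^sub>R y - vert i)" for i
  proof -
    have "u *\<^sub>R x + v *\<^sub>R y - vert i = u *\<^sub>R (x - vert i) + v *\<^sub>R (y - vert i)"
      using uv by (simp add: algebra_simps flip: scaleR_add_left)
    then show ?thesis using xy uv by (simp add: cross2_linear halfplanes_def)
  qed
  then show "u *\<^sub>R x + v *\<^sub>R y \<in> halfplanes" by (simp add: halfplanes_def)
qed

lemma halfplanes_finite: "halfplanes = {x. \<forall>i<k. 0 \<le> cross2 (side i) (x - vert i)}"
proof -
  have "0 \<le> cross2 (side i) (x - vert i)" if "\<forall>i<k. 0 \<le> cross2 (side i) (x - vert i)" for x i
    using that[rule_format, of "i mod k"] k3 by (simp add: period_mod)
  then show ?thesis by (auto simp: halfplanes_def)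
qed

lemma closed_halfplanes: "closed halfplanes"
  unfolding halfplanes_def
  by (intro closed_Collect_all closed_Collect_le continuous_intros)

text \<open>The functionals \<open>cross2 (side i)\<close> are bounded below on the set and sum to
  zero over a turn, so each is bounded above as well. Two consecutive ones are independent and
  therefore bound the point itself.\<close>

lemma bounded_halfplanes: "bounded halfplanes"
proof -
  define c where "c i = cross2 (side i) (vert i)" for i
  define M where "M = (\<Sum>i<k. \<bar>c i\<bar>)"
  have lower: "c i \<le> cross2 (side i) x" if "x \<in> halfplanes" for i x
    using that by (simp add: halfplanes_def cross2_linear c_def)
  have cM: "\<bar>c i\<bar> \<le> M" if "i < k" for i
    unfolding M_def using that by (intro member_le_sum) auto
  have abs: "\<bar>cross2 (side i) x\<bar> \<le> M" if x: "x \<in> halfplanes" and i: "i < k" for i x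
  proof -
    have "(\<Sum>l<k. cross2 (side l) x) = 0"
      using sum_side[of 0] by (simp add: lessThan_atLeast0 flip: cross2_sum_left)
    then have "cross2 (side i) x = - (\<Sum>l\<in>{..<k}-{i}. cross2 (side l) x)"
      using i by (simp add: sum.remove[of _ i])
    also have "\<dots> \<le> - (\<Sum>l\<in>{..<k}-{i}. c l)"
      using lower[OF x] by (simp add: sum_mono)
    also have "\<dots> \<le> (\<Sum>l\<in>{..<k}-{i}. \<bar>c l\<bar>)"
      by (subst sum_negf[symmetric]) (intro sum_mono, simp)
    also have "\<dots> \<le> M" unfolding M_def by (intro sum_mono2) auto
    finally have "cross2 (side i) x \<le> M" .
    moreover have "- M \<le> cross2 (side i) x" using cM[OF i] lower[OF x, of i] by linarith
    ultimately show ?thesis by (simp add: abs_le_iff)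
  qed
  define d where "d = cross2 (side 0) (side (Suc 0))"
  have d: "0 < d" unfolding d_def by (rule cross2_adjacent)
  have "norm x \<le> (2 * M * r) / d" if x: "x \<in> halfplanes" for x
  proof -
    \<comment> \<open>Cramer's rule for \<open>x\<close> in the basis \<open>side 0\<close>,
      \<open>side (Suc 0)\<close>.\<close>
    have "d *\<^sub>R x = cross2 (side 0) x *\<^sub>R side (Suc 0) - cross2 (side (Suc 0)) x *\<^sub>R side 0"
      by (simp add: d_def vec_eq_iff forall_2 cross2_def algebra_simps)
    then have "norm (d *\<^sub>R x) \<le> \<bar>cross2 (side 0) x\<bar> * r + \<bar>cross2 (side (Suc 0)) x\<bar> * r"
      using norm_triangle_ineq4[of "cross2 (side 0) x *\<^sub>R side (Suc 0)" "cross2 (side (Suc 0)) x *\<^sub>R side 0"]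
      by (simp add: norm_side)
    also have "\<dots> \<le> M * r + M * r"
      using abs[OF x, of 0] abs[OF x, of "Suc 0"] k3 r0
      by (intro add_mono mult_right_mono) auto
    finally show ?thesis using d by (simp add: field_simps)
  qed
  then show ?thesis by (auto simp: bounded_iff)
qed

lemma cross2_on_side:
  assumes "x \<in> closed_segment (vert i) (vert (Suc i))"
  shows "cross2 (side i) (x - vert i) = 0"
  using assms by (auto simp: in_segment vert_Suc algebra_simps cross2_linear)

text \<open>A frontier point satisfies some constraint \<open>i\<close> with equality, since strict
  inequalities define an open subset. On that line the constraints of the next and the previous side
  cut out exactly the segment. Conversely, a point of a side leaves the set under an arbitrarily
  small outward shift.\<close>

lemma frontier_halfplanes:
  "frontier halfplanes = (\<Union>i<k. closed_segment (vert i) (vert (Suc i)))" (is "_ = ?B")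
proof
  show "frontier halfplanes \<subseteq> ?B"
  proof
    fix x assume "x \<in> frontier halfplanes"
    then have xH: "x \<in> halfplanes" and xi: "x \<notin> interior halfplanes"
      using closed_halfplanes by (auto simp: frontier_def)
    define U where "U = (\<Inter>i<k. {x. 0 < cross2 (side i) (x - vert i)})"
    have "open U" unfolding U_def
      by (intro open_INT ballI open_Collect_less continuous_intros) auto
    moreover have "U \<subseteq> halfplanes" unfolding halfplanes_finite U_def by (auto intro: less_imp_le)
    ultimately have "x \<notin> U" using xi interior_maximal by blast
    then obtain i where i: "i < k" "cross2 (side i) (x - vert i) = 0"
      using xH by (auto simp: U_def halfplanes_def not_less intro: antisym)
    have "side i \<noteq> 0" using norm_side[of i] r0 by auto
    then obtain t where t: "x - vert i = t *\<^sub>R side i"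
      using cross2_eq_0_imp_parallel i(2) by metis
    have anti: "cross2 (side (Suc i)) (side i) = - cross2 (side i) (side (Suc i))"
      by (simp add: cross2_def)
    have eq: "x - vert (Suc i) = (t - 1) *\<^sub>R side i"
      using t by (simp add: vert_Suc algebra_simps)
    have "0 \<le> cross2 (side (Suc i)) (x - vert (Suc i))"
      using xH by (simp add: halfplanes_def)
    then have "0 \<le> (1 - t) * cross2 (side i) (side (Suc i))"
      unfolding eq cross2_linear anti by (simp add: algebra_simps)
    then have t1: "t \<le> 1" using cross2_adjacent[of i] by (simp add: zero_le_mult_iff)
    \<comment> \<open>The side before \<open>i\<close>, taken one period later so that the
      subtraction is safe for \<open>i = 0\<close>.\<close>
    define j where "j = i + k - 1"
    have j: "Suc j = i + k" using k3 by (simp add: j_def)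
    have "vert i = vert j + side j" "side (Suc j) = side i"
      using vert_Suc[of j] by (simp_all add: j vert_period side_period)
    then have eq: "x - vert j = side j + t *\<^sub>R side (Suc j)"
      using t by (simp add: algebra_simps)
    have "0 \<le> cross2 (side j) (x - vert j)" using xH by (simp add: halfplanes_def)
    then have "0 \<le> t * cross2 (side j) (side (Suc j))"
      unfolding eq cross2_linear by simp
    then have t0: "0 \<le> t" using cross2_adjacent[of j] by (simp add: zero_le_mult_iff)
    have "x = (1 - t) *\<^sub>R vert i + t *\<^sub>R vert (Suc i)"
      using t by (simp add: vert_Suc algebra_simps)
    then show "x \<in> ?B" using t0 t1 i(1) by (auto simp: in_segment)
  qed
  show "?B \<subseteq> frontier halfplanes"
  proof
    fix x assume "x \<in> ?B"
    then obtain i where i: "x \<in> closed_segment (vert i) (vert (Suc i))" by auto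
    have "closed_segment (vert i) (vert (Suc i)) \<subseteq> halfplanes"
      by (intro closed_segment_subset vert_in_halfplanes convex_halfplanes)
    then have xH: "x \<in> halfplanes" using i by auto
    \<comment> \<open>\<open>side i\<close> turned left by a right angle: the inward normal, so that
      subtracting a multiple of it violates constraint \<open>i\<close>.\<close>
    define w :: "real^2" where "w = vector [- side i $ 2, side i $ 1]"
    have w: "cross2 (side i) w = r\<^sup>2"
      using norm_side[of i] r0
      by (simp add: w_def cross2_def norm_vec_def L2_set_def sum_2 power2_eq_square real_sqrt_eq_iff)
        (metis abs_of_pos power2_eq_square real_sqrt_abs real_sqrt_eq_iff)
    have "x \<notin> interior halfplanes"
    proof
      assume "x \<in> interior halfplanes"
      then obtain e where e: "0 < e" "ball x e \<subseteq> halfplanes"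
        using mem_interior by blast
      have wn: "w \<noteq> 0" using w r0 by auto
      define s where "s = e / (2 * norm w)"
      have s: "0 < s" using e wn by (simp add: s_def)
      have "x - s *\<^sub>R w \<in> ball x e"
        using e wn by (simp add: s_def dist_norm)
      then have "x - s *\<^sub>R w \<in> halfplanes" using e(2) by (rule rev_subsetD)
      then have "0 \<le> cross2 (side i) (x - s *\<^sub>R w - vert i)"
        by (simp add: halfplanes_def)
      also have "x - s *\<^sub>R w - vert i = (x - vert i) - s *\<^sub>R w" by simp
      also have "cross2 (side i) \<dots> = - s * r\<^sup>2"
        using cross2_on_side[OF i] w by (simp add: cross2_linear)
      finally have "s * r\<^sup>2 \<le> 0" by simp
      then show False using s r0 by (simp add: mult_le_0_iff)
    qed
    then show "x \<in> frontier halfplanes" using xH closed_halfplanes by (simp add: frontier_def)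
  qed
qed

section \<open>The partial sums as a simple convex equilateral polygon\<close>

definition verts :: "(real^2) list" where
  "verts = map vert [0..<k]"

lemma length_verts [simp]: "length verts = k"
  by (simp add: verts_def)

lemma nth_verts [simp]: "i < k \<Longrightarrow> verts ! i = vert i"
  by (simp add: verts_def)

lemma nth_verts_mod [simp]: "verts ! (i mod k) = vert i"
  using k3 by (simp add: vert_mod)

text \<open>For non-adjacent sides both endpoints of the second segment lie strictly to the left of
  the line through the first, hence so does the whole segment.\<close>

lemma disjoint_sides:
  assumes "i < k" "j < k" "i \<noteq> j" "j \<noteq> Suc i mod k" "i \<noteq> Suc j mod k"
  shows "closed_segment (vert i) (vert (Suc i)) \<inter> closed_segment (vert j) (vert (Suc j)) = {}"
proof -
  \<comment> \<open>Shifted so that \<open>j'\<close> and \<open>Suc j'\<close> both lie strictly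
    between \<open>Suc i\<close> and \<open>i + k\<close>, the range in which
    \<open>cross2_vert\<close> is strict.\<close>
  define j' where "j' = (if i < j then j else j + k)"
  have ij: "Suc i < j'" "Suc j' < i + k"
    using assms by (auto simp: j'_def mod_Suc split: if_splits)
  have "vert j' = vert j" "vert (Suc j') = vert (Suc j)"
    using vert_period[of "Suc j"] by (auto simp: j'_def vert_period)
  then have pos: "0 < cross2 (side i) (vert j - vert i)" "0 < cross2 (side i) (vert (Suc j) - vert i)"
    using cross2_vert(2)[of i j'] cross2_vert(2)[of i "Suc j'"] ij by auto
  show ?thesis
  proof (rule equals0I)
    fix x assume x: "x \<in> closed_segment (vert i) (vert (Suc i)) \<inter> closed_segment (vert j) (vert (Suc j))"
    then obtain u where u: "0 \<le> u" "u \<le> 1" "x = (1 - u) *\<^sub>R vert j + u *\<^sub>R vert (Suc j)"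
      by (auto simp: in_segment)
    then have "x - vert i = (1 - u) *\<^sub>R (vert j - vert i) + u *\<^sub>R (vert (Suc j) - vert i)"
      by (simp add: algebra_simps)
    then have "cross2 (side i) (x - vert i)
        = (1 - u) * cross2 (side i) (vert j - vert i) + u * cross2 (side i) (vert (Suc j) - vert i)"
      by (simp add: cross2_linear)
    also have "\<dots> > 0"
    proof (cases "u = 1")
      case False
      then show ?thesis using pos u by (intro add_pos_nonneg) auto
    qed (use pos in auto)
    finally show False using cross2_on_side x by auto
  qed
qed

lemma distinct_verts: "distinct verts"
proof -
  have "vert i \<noteq> vert j" if "i < j" "j < k" for i j
  proof (cases "j = Suc i")
    case True
    then show ?thesis using norm_side[of i] r0 by (auto simp: vert_Suc)
  next
    case False
    then have "0 < cross2 (side i) (vert j - vert i)"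
      using that by (intro cross2_vert(2)) auto
    then show ?thesis by auto
  qed
  then show ?thesis
    unfolding verts_def distinct_map by (auto simp: inj_on_def) (metis nat_neq_iff)
qed

lemma not_collinear_verts: "\<not> collinear {vert i, vert (Suc i), vert (Suc (Suc i))}"
proof
  assume "collinear {vert i, vert (Suc i), vert (Suc (Suc i))}"
  then obtain u where u: "\<forall>x\<in>{vert i, vert (Suc i), vert (Suc (Suc i))}.
      \<forall>y\<in>{vert i, vert (Suc i), vert (Suc (Suc i))}. \<exists>c. x - y = c *\<^sub>R u"
    unfolding collinear_def by auto
  have "vert (Suc i) - vert i = side i" "vert (Suc (Suc i)) - vert (Suc i) = side (Suc i)"
    by (simp_all add: vert_Suc)
  then obtain a b where "side i = a *\<^sub>R u" "side (Suc i) = b *\<^sub>R u"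
    using u by (metis insertCI)
  then have "cross2 (side i) (side (Suc i)) = 0" by (simp add: cross2_def)
  then show False using cross2_adjacent[of i] by simp
qed

lemma polygon_verts: "polygon verts"
  unfolding polygon_def Let_def polygon_side_def
  using k3 distinct_verts disjoint_sides not_collinear_verts by simp

text \<open>For a bounded convex set the inside of the frontier is the interior, so the region is
  \<open>halfplanes\<close> and no Jordan curve argument enters.\<close>

lemma convex_polygon_verts: "convex_polygon verts"
proof -
  have "polygon_boundary verts = frontier halfplanes"
    by (simp add: polygon_boundary_def polygon_side_def frontier_halfplanes)
  then have "polygon_region verts = frontier halfplanes \<union> interior halfplanes"
    using bounded_halfplanes convex_halfplanes
    by (simp add: polygon_region_def inside_frontier_eq_interior)
  also have "\<dots> = halfplanes"
    using closed_halfplanes interior_subset[of halfplanes] by (auto simp: frontier_def)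
  finally show ?thesis using polygon_verts convex_halfplanes by (simp add: convex_polygon_def)
qed

lemma equilateral_verts: "equilateral verts"
  unfolding equilateral_def
  by (rule exI[of _ r]) (simp add: dist_norm vert_Suc norm_side norm_minus_commute)

end

text \<open>Members of a set of vectors of one length have distinct arguments in [0, 2 pi), so
  sorting gives strictly increasing angles. The vertices are partial sums starting at 0, which is
  why closure of \<open>L\<close> under adding members of \<open>V\<close> suffices.\<close>

lemma convex_equilateral_gon_of_vectors:
  fixes V :: "(real^2) set"
  assumes card: "card V = k" and k3: "3 \<le> k" and r0: "0 < r"
    and norm: "\<And>v. v \<in> V \<Longrightarrow> norm v = r" and sum0: "\<Sum>V = 0"
    and L: "0 \<in> L" "\<And>x v. x \<in> L \<Longrightarrow> v \<in> V \<Longrightarrow> x + v \<in> L"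
  shows "contains_convex_equilateral_gon L k"
proof -
  define pt :: "real \<Rightarrow> real^2" where "pt t = r *\<^sub>R vector [cos t, sin t]" for t
  have "\<exists>t. 0 \<le> t \<and> t < 2 * pi \<and> v = pt t" if "v \<in> V" for v
  proof -
    have "(v$1)\<^sup>2 + (v$2)\<^sup>2 = r\<^sup>2"
      using norm[OF that] r0
      by (simp add: norm_vec_def L2_set_def sum_2) (metis real_sqrt_pow2 sum_power2_ge_zero)
    then have "(v$1 / r)\<^sup>2 + (v$2 / r)\<^sup>2 = 1"
      using r0 by (simp add: power_divide flip: add_divide_distrib)
    then obtain t where "0 \<le> t" "t < 2 * pi" "v$1 / r = cos t" "v$2 / r = sin t"
      by (rule sincos_total_2pi) blast
    then show ?thesis
      using r0 by (intro exI[of _ t]) (auto simp: pt_def vec_eq_iff forall_2 field_simps)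
  qed
  then obtain ang where ang: "\<And>v. v \<in> V \<Longrightarrow> 0 \<le> ang v" "\<And>v. v \<in> V \<Longrightarrow> ang v < 2 * pi"
      "\<And>v. v \<in> V \<Longrightarrow> pt (ang v) = v"
    by metis
  have fin: "finite V" using card k3 by (auto intro: card_ge_0_finite)
  have inj: "inj_on ang V" using ang(3) by (metis inj_onI)
  define ts where "ts = sorted_list_of_set (ang ` V)"
  have len: "length ts = k" and set_ts: "set ts = ang ` V"
    using fin inj card by (simp_all add: ts_def card_image)
  have ts_distinct: "distinct ts" by (simp add: ts_def)
  have ts_less: "ts ! i < ts ! j" if "i < j" "j < k" for i j
    using that len strict_sorted_list_of_set[of "ang ` V"]
    by (auto simp: ts_def sorted_wrt_iff_nth_less)
  have ts_range: "0 \<le> ts ! i" "ts ! i < 2 * pi" if "i < k" for i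
    using that len set_ts ang nth_mem[of i ts] by auto
  \<comment> \<open>The sorted arguments continued beyond one turn: each further block of
    \<open>k\<close> indices adds 2 pi.\<close>
  define \<theta> where "\<theta> i = ts ! (i mod k) + 2 * pi * real (i div k)" for i
  have bij: "bij_betw (\<lambda>i. pt (\<theta> i)) {..<k} V"
  proof -
    have "bij_betw ((!) ts) {..<k} (ang ` V)"
      using len by (intro bij_betw_nth) (simp_all add: set_ts ts_distinct)
    moreover have "bij_betw pt (ang ` V) V"
      by (rule bij_betw_byWitness[of _ ang]) (auto simp: ang)
    ultimately have "bij_betw (pt \<circ> (!) ts) {..<k} V" by (rule bij_betw_trans)
    then show ?thesis by (rule bij_betw_cong[THEN iffD1, rotated]) (simp add: \<theta>_def)
  qed
  interpret turning_vectors k r \<theta>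
  proof
    show "strict_mono \<theta>"
    proof (rule strict_monoI)
      fix i j :: nat assume "i < j"
      show "\<theta> i < \<theta> j"
      proof (cases "i div k = j div k")
        case True
        then have "i mod k < j mod k"
          using \<open>i < j\<close> by (metis add_less_cancel_left div_mult_mod_eq)
        then show ?thesis using True k3 by (simp add: \<theta>_def ts_less)
      next
        case False
        then have "i div k + 1 \<le> j div k"
          using \<open>i < j\<close> by (metis Suc_eq_plus1 Suc_leI div_le_mono le_neq_implies_less less_imp_le)
        then have "2 * pi * real (i div k) + 2 * pi \<le> 2 * pi * real (j div k)"
          using mult_left_mono[of "real (i div k) + 1" "real (j div k)" "2 * pi"]
          by (simp add: algebra_simps)
        moreover have "ts ! (i mod k) < 2 * pi" "0 \<le> ts ! (j mod k)"
          using ts_range k3 by simp_all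
        ultimately show ?thesis by (simp add: \<theta>_def)
      qed
    qed
    show "\<theta> (i + k) = \<theta> i + 2 * pi" for i
      using k3 by (simp add: \<theta>_def algebra_simps)
    show "(\<Sum>i<k. r *\<^sub>R (vector [cos (\<theta> i), sin (\<theta> i)] :: real^2)) = 0"
      using sum.reindex_bij_betw[OF bij, of "\<lambda>v. v"] sum0 by (simp add: pt_def)
  qed (use k3 r0 in auto)
  have "side i \<in> V" if "i < k" for i
    using bij_betwE[OF bij] that by (auto simp: side_def pt_def)
  then have "vert i \<in> L" if "i \<le> k" for i
    using that by (induction i) (auto simp: vert_def L)
  then have "set verts \<subseteq> L" by (auto simp: verts_def)
  then show ?thesis
    unfolding contains_convex_equilateral_gon_def
    using convex_polygon_verts equilateral_verts length_verts by blast
qed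

section \<open>Zero-sum sets of norm-one elements\<close>

text \<open>Points \<open>(x, y)\<close> of the conic stand for elements \<open>x + y \<surd>-\<nu>\<close> of norm \<open>1\<close>
  of the imaginary quadratic field.\<close>
definition unit_config :: "nat \<Rightarrow> nat \<Rightarrow> bool" where
  "unit_config \<nu> k \<longleftrightarrow> (\<exists>V::(rat \<times> rat) set. finite V \<and> card V = k \<and>
     (\<forall>(x, y)\<in>V. x\<^sup>2 + of_nat \<nu> * y\<^sup>2 = 1) \<and> sum fst V = 0 \<and> sum snd V = 0)"

text \<open>The conic has infinitely many rational points, so some opposite pair avoids the finite
  set \<open>V\<close>; adding the pair leaves both coordinate sums at zero.\<close>

lemma unit_config_add_2:
  assumes "unit_config \<nu> k" "0 < \<nu>"
  shows "unit_config \<nu> (k + 2)"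
proof -
  obtain V :: "(rat \<times> rat) set" where V: "finite V" "card V = k"
      "\<And>x y. (x, y) \<in> V \<Longrightarrow> x\<^sup>2 + of_nat \<nu> * y\<^sup>2 = 1" "sum fst V = 0" "sum snd V = 0"
    using assms(1) by (auto simp: unit_config_def)
  define q :: "nat \<Rightarrow> rat" where "q t = 1 + of_nat \<nu> * (of_nat t)\<^sup>2" for t
  \<comment> \<open>The second intersection of the conic with the line of slope \<open>t\<close>
    through (-1, 0).\<close>
  define w :: "nat \<Rightarrow> rat \<times> rat" where "w t = (2 / q t - 1, 2 * of_nat t / q t)" for t
  have q: "0 < q t" for t
    unfolding q_def by (intro add_pos_nonneg) auto
  have "inj w"
  proof (rule injI)
    fix s t assume "w s = w t"
    then have "q s = q t" using q[of s] q[of t] by (simp add: w_def field_simps)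
    then show "s = t" using assms(2) by (simp add: q_def flip: of_nat_power)
  qed
  then have "infinite (range w)" by (simp add: finite_image_iff)
  then obtain t where t: "w t \<notin> V \<union> uminus ` V"
    using V(1) by (metis finite_Un finite_imageI finite_subset image_subset_iff rangeE subsetI)
  have unit: "(fst (w t))\<^sup>2 + of_nat \<nu> * (snd (w t))\<^sup>2 = 1"
  proof -
    have "(2 - q t)\<^sup>2 + of_nat \<nu> * (2 * of_nat t)\<^sup>2 = (q t)\<^sup>2"
      by (simp add: q_def power2_eq_square algebra_simps)
    moreover have "2 / q t - 1 = (2 - q t) / q t" using q[of t] by (simp add: field_simps)
    ultimately show ?thesis
      using q[of t] by (simp add: w_def power_divide flip: add_divide_distrib)
  qed
  have notin: "w t \<notin> V" "- w t \<notin> V" using t by (auto simp: image_iff)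
  have ne: "w t \<noteq> - w t"
  proof
    assume "w t = - w t"
    then have "fst (w t) = 0" "snd (w t) = 0" by (auto simp: prod_eq_iff)
    then show False using unit by simp
  qed
  show ?thesis unfolding unit_config_def
    using V notin ne unit
    by (intro exI[of _ "insert (w t) (insert (- w t) V)"]) (auto simp: case_prod_unfold)
qed

lemma unit_config_even:
  assumes "0 < \<nu>"
  shows "unit_config \<nu> (2 * j)"
proof (induction j)
  case 0
  show ?case unfolding unit_config_def by (rule exI[of _ "{}"]) simp
next
  case (Suc j)
  then show ?case using unit_config_add_2[OF _ assms, of "2 * j"] by simp
qed

text \<open>Opposite pairs change the size by 2. Odd \<open>k\<close> is reached from the given set
  of odd size \<open>m\<close>, even \<open>k\<close> from the empty set.\<close>

lemma unit_config_mono: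
  assumes "unit_config \<nu> m" "0 < \<nu>" "odd m" "m \<le> k"
  shows "unit_config \<nu> k"
proof (cases "even k")
  case True
  then show ?thesis using unit_config_even[OF assms(2)] by (auto elim: evenE)
next
  case False
  have "unit_config \<nu> (m + 2 * j)" for j
    using assms(1) by (induction j) (auto dest: unit_config_add_2[OF _ assms(2)] simp: add.commute)
  moreover obtain j where "k = m + 2 * j"
  proof -
    have "even (k - m)" using False assms by simp
    then show ?thesis using assms(4) that by (metis evenE le_add_diff_inverse)
  qed
  ultimately show ?thesis by simp
qed

text \<open>\<open>X\<close> is a common denominator. The premises become integer computations on an
  explicit list, which the simplifier can evaluate.\<close>

lemma unit_config_of_list:
  fixes X :: int
  assumes "X \<noteq> 0" "distinct xs" "sum_list (map fst xs) = 0" "sum_list (map snd xs) = 0"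
    and "\<forall>(x, y)\<in>set xs. x\<^sup>2 + int \<nu> * y\<^sup>2 = X\<^sup>2" and "length xs = k"
  shows "unit_config \<nu> k"
proof -
  define g :: "int \<times> int \<Rightarrow> rat \<times> rat" where "g v = (of_int (fst v) / of_int X, of_int (snd v) / of_int X)" for v
  have inj: "inj_on g S" for S
    using assms(1) by (auto simp: inj_on_def g_def)
  have "sum fst (g ` set xs) = of_int (sum fst (set xs)) / of_int X"
    "sum snd (g ` set xs) = of_int (sum snd (set xs)) / of_int X"
    unfolding sum.reindex[OF inj] by (simp_all add: g_def sum_divide_distrib)
  moreover have "sum fst (set xs) = 0" "sum snd (set xs) = 0"
    using assms by (simp_all flip: sum_list_distinct_conv_sum_set)
  moreover have "(fst (g v))\<^sup>2 + of_nat \<nu> * (snd (g v))\<^sup>2 = 1" if "v \<in> set xs" for v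
  proof -
    have "(fst v)\<^sup>2 + int \<nu> * (snd v)\<^sup>2 = X\<^sup>2" using assms(5) that by auto
    from arg_cong[OF this, of "of_int :: int \<Rightarrow> rat"]
    have "(of_int (fst v))\<^sup>2 + of_nat \<nu> * (of_int (snd v))\<^sup>2 = (of_int X :: rat)\<^sup>2"
      by simp
    then show ?thesis
      using assms(1) by (simp add: g_def power_divide flip: add_divide_distrib)
  qed
  moreover have "card (g ` set xs) = k"
    using assms by (simp add: card_image[OF inj] distinct_card)
  ultimately show ?thesis unfolding unit_config_def
    by (intro exI[of _ "g ` set xs"]) (auto simp: case_prod_unfold)
qed

text \<open>The following sets were found by computer search among those invariant under
  \<open>(x, y) \<mapsto> (x, - y)\<close>. For \<open>\<nu> = 15\<close> no such set turned up, and an asymmetric one is used.\<close>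
lemma unit_config_3: "unit_config 3 3"
  by (rule unit_config_of_list[of 2 "
    [(2, 0), (-1, 1), (-1, -1)]"]) simp_all

lemma unit_config_7: "unit_config 7 7"
  by (rule unit_config_of_list[of 88 "
    [(88, 0), (-87, 5), (-87, -5), (-38, 30), (-38, -30), (81, 13), (81, -13)]"]) simp_all

lemma unit_config_11: "unit_config 11 11"
  by (rule unit_config_of_list[of 90 "
    [(90, 0), (-86, 8), (-86, -8), (-42, 24), (-42, -24), (-9, 27), (-9, -27), (35, 25),
     (35, -25), (57, 21), (57, -21)]"]) simp_all

lemma unit_config_15: "unit_config 15 5"
  by (rule unit_config_of_list[of 483724 "
    [(483724, 0), (445129, -48887), (-483631, 2449), (-379901, -77315), (-65321, 123753)]"]) simp_all

lemma unit_config_35: "unit_config 35 7"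
  by (rule unit_config_of_list[of 17226 "
    [(17226, 0), (-17081, 377), (-17081, -377), (-4726, 2800), (-4726, -2800), (13194, 1872),
     (13194, -1872)]"]) simp_all

lemma unit_config_39: "unit_config 39 13"
  by (rule unit_config_of_list[of 440 "
    [(440, 0), (-418, 22), (-418, -22), (-392, 32), (-392, -32), (-275, 55), (-275, -55),
     (154, 66), (154, -66), (310, 50), (310, -50), (401, 29), (401, -29)]"]) simp_all

lemma unit_config_55: "unit_config 55 11"
  by (rule unit_config_of_list[of 728 "
    [(728, 0), (-702, 26), (-702, -26), (-658, 42), (-658, -42), (-273, 91), (-273, -91),
     (552, 64), (552, -64), (717, 17), (717, -17)]"]) simp_all

lemma unit_config_91: "unit_config 91 13"
  by (rule unit_config_of_list[of 16790 "
    [(16790, 0), (-16698, 184), (-16698, -184), (-5037, 1679), (-5037, -1679), (150, 1760),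
     (150, -1760), (1606, 1752), (1606, -1752), (3335, 1725), (3335, -1725), (8249, 1533),
     (8249, -1533)]"]) simp_all

lemma unit_config_143: "unit_config 143 13"
  by (rule unit_config_of_list[of 23184 "
    [(23184, 0), (-22953, 273), (-22953, -273), (-15088, 1472), (-15088, -1472),
     (-10512, 1728), (-10512, -1728), (-1932, 1932), (-1932, -1932), (17802, 1242),
     (17802, -1242), (21091, 805), (21091, -805)]"]) simp_all

lemma unit_config_195: "unit_config 195 13"
  by (rule unit_config_of_list[of 1666 "
    [(1666, 0), (-1649, 17), (-1649, -17), (-1519, 49), (-1519, -49), (-791, 105),
     (-791, -105), (119, 119), (119, -119), (1406, 64), (1406, -64), (1601, 33), (1601, -33)]"]) simp_all

lemma unit_config_231: "unit_config 231 11"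
  by (rule unit_config_of_list[of 800 "
    [(800, 0), (-740, 20), (-740, -20), (-520, 40), (-520, -40), (-124, 52), (-124, -52),
     (415, 45), (415, -45), (569, 37), (569, -37)]"]) simp_all

lemma unit_config_455: "unit_config 455 13"
  by (rule unit_config_of_list[of 15504 "
    [(15504, 0), (-15371, 95), (-15371, -95), (-9456, 576), (-9456, -576), (-8364, 612),
     (-8364, -612), (7106, 646), (7106, -646), (7769, 629), (7769, -629), (10564, 532),
     (10564, -532)]"]) simp_all

lemma unit_config_715: "unit_config 715 13"
  by (rule unit_config_of_list[of 42139226 "
    [(42139226, 0), (-35459399, 851445), (-35459399, -851445), (-29941029, 1108927),
     (-29941029, -1108927), (-12293399, 1507365), (-12293399, -1507365), (-11862969, 1512181),
     (-11862969, -1512181), (34206054, 920368), (34206054, -920368), (34281129, 916453),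
     (34281129, -916453)]"]) simp_all

lemma unit_config_1155: "unit_config 1155 11"
  by (rule unit_config_of_list[of 1530374 "
    [(1530374, 0), (-1388234, 18952), (-1388234, -18952), (-796214, 38456), (-796214, -38456),
     (-373066, 43672), (-373066, -43672), (336566, 43928), (336566, -43928), (1455761, 13889),
     (1455761, -13889)]"]) simp_all

lemma unit_config_3003: "unit_config 3003 13"
  by (rule unit_config_of_list[of 319272658 "
    [(319272658, 0), (-303995858, 1780640), (-303995858, -1780640), (-296819689, 2146259),
     (-296819689, -2146259), (-110711767, 5464685), (-110711767, -5464685),
     (123788642, 5370440), (123788642, -5370440), (142850542, 5210480), (142850542, -5210480),
     (285251801, 2616989), (285251801, -2616989)]"]) simp_all

lemma unit_config_15015: "unit_config 15015 13"
  by (rule unit_config_of_list[of 33070304 "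
    [(33070304, 0), (-31588901, 79871), (-31588901, -79871), (-18919816, 221352),
     (-18919816, -221352), (-12489821, 249895), (-12489821, -249895), (-2958299, 268801),
     (-2958299, -268801), (18546184, 223448), (18546184, -223448), (30875501, 96681),
     (30875501, -96681)]"]) simp_all

text \<open>A square-free number is the product of its set of prime factors, so only the 32 subsets
  of the five primes have to be inspected. The congruence discards half of them, among them the
  empty set with product 1.\<close>

lemma unit_config_cases:
  assumes S: "prime_factors \<nu> \<subseteq> {3, 5, 7, 11, 13}" and sf: "squarefree \<nu>"
    and mod4: "[\<nu> = 3] (mod 4)"
  shows "unit_config \<nu> (Max (prime_factors \<nu>))"
proof -
  have "\<nu> \<noteq> 0" using mod4 by (auto simp: cong_def)
  then have "\<nu> = (\<Prod>p\<in>prime_factors \<nu>. p ^ multiplicity p \<nu>)"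
    by (simp add: prime_factorization_nat)
  also have "\<dots> = \<Prod>(prime_factors \<nu>)"
    using sf \<open>\<nu> \<noteq> 0\<close> by (intro prod.cong) (auto simp: squarefree_factorial_semiring')
  finally have prod: "\<nu> = \<Prod>(prime_factors \<nu>)" .
  have "prime_factors \<nu> \<in> Pow {3, 5, 7, 11, 13}" using S by simp
  then have "[\<Prod>(prime_factors \<nu>) = 3] (mod 4) \<longrightarrow>
      unit_config (\<Prod>(prime_factors \<nu>)) (Max (prime_factors \<nu>))"
    by (simp only: Pow_insert Pow_empty image_insert image_empty Un_insert_left Un_insert_right
        Un_empty_left Un_empty_right insert_iff empty_iff)
      (elim disjE FalseE; simp add: cong_def unit_config_3 unit_config_7 unit_config_11 unit_config_15
        unit_config_35 unit_config_39 unit_config_55 unit_config_91 unit_config_143 unit_config_195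
        unit_config_231 unit_config_455 unit_config_715 unit_config_1155 unit_config_3003
        unit_config_15015)
  then show ?thesis using prod mod4 by metis
qed

lemma odd_prime_less_17:
  fixes p :: nat
  assumes "prime p" "p < 17" "odd p"
  shows "p \<in> {3, 5, 7, 11, 13}"
proof -
  have "p = 9 \<or> p = 15 \<or> p = 3 \<or> p = 5 \<or> p = 7 \<or> p = 11 \<or> p = 13"
    using assms(2,3) prime_gt_1_nat[OF assms(1)] by presburger
  moreover have "\<not> prime (9::nat)" "\<not> prime (15::nat)" by simp_all
  ultimately show ?thesis using assms by auto
qed

section \<open>Lattices and their Gram matrices\<close>

lemma lattice_gen_iff: "x \<in> lattice_gen a b \<longleftrightarrow> (\<exists>m n. x = of_int m *\<^sub>R a + of_int n *\<^sub>R b)"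
  by (auto simp: lattice_gen_def)

lemma lattice_gen_add:
  assumes "x \<in> lattice_gen a b" "y \<in> lattice_gen a b"
  shows "x + y \<in> lattice_gen a b"
proof -
  obtain m n m' n' where "x = of_int m *\<^sub>R a + of_int n *\<^sub>R b" "y = of_int m' *\<^sub>R a + of_int n' *\<^sub>R b"
    using assms by (auto simp: lattice_gen_iff)
  then have "x + y = of_int (m + m') *\<^sub>R a + of_int (n + n') *\<^sub>R b" by (simp add: algebra_simps)
  then show ?thesis unfolding lattice_gen_iff by blast
qed

lemma lattice_gen_scale:
  assumes "x \<in> lattice_gen a b"
  shows "of_int k *\<^sub>R x \<in> lattice_gen a b"
proof -
  obtain m n where "x = of_int m *\<^sub>R a + of_int n *\<^sub>R b"
    using assms by (auto simp: lattice_gen_iff)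
  then have "of_int k *\<^sub>R x = of_int (k * m) *\<^sub>R a + of_int (k * n) *\<^sub>R b" by (simp add: algebra_simps)
  then show ?thesis unfolding lattice_gen_iff by blast
qed

lemma lattice_gen_diff:
  assumes "x \<in> lattice_gen a b" "y \<in> lattice_gen a b"
  shows "x - y \<in> lattice_gen a b"
  using lattice_gen_add[OF assms(1) lattice_gen_scale[OF assms(2), of "- 1"]] by simp

lemma zero_in_lattice_gen: "0 \<in> lattice_gen a b"
  unfolding lattice_gen_iff by (intro exI[of _ 0]) simp

lemma generators_in_lattice_gen: "a \<in> lattice_gen a b" "b \<in> lattice_gen a b"
  unfolding lattice_gen_iff
  by (rule exI[of _ 1], rule exI[of _ 0], simp) (rule exI[of _ 0], rule exI[of _ 1], simp)

lemma cross2_independent: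
  assumes "cross2 a b \<noteq> 0" "u *\<^sub>R a + v *\<^sub>R b = 0"
  shows "u = 0" "v = 0"
proof -
  have "cross2 (u *\<^sub>R a + v *\<^sub>R b) b = u * cross2 a b" "cross2 a (u *\<^sub>R a + v *\<^sub>R b) = v * cross2 a b"
    by (simp_all add: cross2_def algebra_simps)
  then have "u * cross2 a b = 0" "v * cross2 a b = 0" by (simp_all only: assms(2) cross2_simps)
  then show "u = 0" "v = 0" using assms(1) by simp_all
qed

lemma lattice_basis_cross2: "lattice_basis a b L \<Longrightarrow> cross2 a b \<noteq> 0"
  using lattice_basis_det_nonzero by (simp add: det_vector_2 cross2_def)

lemma lattice_basisI:
  assumes "cross2 a b \<noteq> 0"
  shows "lattice_basis a b (lattice_gen a b)"
proof -
  have "b \<noteq> 0" "a \<noteq> b" using assms by auto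
  moreover have "a \<notin> span {b}"
  proof
    assume "a \<in> span {b}"
    then obtain t where "a = t *\<^sub>R b" by (auto simp: span_singleton)
    then show False using assms by (simp add: cross2_def)
  qed
  ultimately show ?thesis by (simp add: lattice_basis_def independent_insert)
qed

text \<open>Lagrange's identity: the squared area is the Gram determinant, hence computable from
  inner products alone.\<close>

lemma cross2_square: "(cross2 a b)\<^sup>2 = (a \<bullet> a) * (b \<bullet> b) - (a \<bullet> b)\<^sup>2"
  by (simp add: cross2_def inner_vec_def sum_2 power2_eq_square algebra_simps)

lemma lattice_area_gram:
  assumes "lattice_basis a b L"
  shows "(lattice_area L)\<^sup>2 = (a \<bullet> a) * (b \<bullet> b) - (a \<bullet> b)\<^sup>2"
  using lattice_area_eq[OF assms] by (simp add: det_vector_2 flip: cross2_square cross2_def)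

lemma lattice_nu:
  assumes "planar_lattice L" "integral_lattice L"
  shows "squarefree (lattice_nu L)"
    and "\<exists>k::int. (lattice_area L)\<^sup>2 = (of_int k)\<^sup>2 * of_nat (lattice_nu L)"
  using theI'[OF lattice_nu_unique[OF assms]] by (simp_all add: lattice_nu_def)

text \<open>An isometry of lattices need not fix the origin; subtracting its value at \<open>0\<close> makes it
  preserve inner products, hence additive.\<close>
lemma similar_lattices_gram:
  assumes basis: "lattice_basis a b L" and sim: "similar_lattices L L'" and L': "planar_lattice L'"
  obtains c a' b' where "0 < c" "lattice_basis a' b' L'"
    "a' \<bullet> a' = c\<^sup>2 * (a \<bullet> a)" "a' \<bullet> b' = c\<^sup>2 * (a \<bullet> b)" "b' \<bullet> b' = c\<^sup>2 * (b \<bullet> b)"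
proof -
  obtain c f where c: "0 < c" and img: "f ` (\<lambda>x. c *\<^sub>R x) ` L = L'"
    and iso: "\<And>x y. x \<in> L \<Longrightarrow> y \<in> L \<Longrightarrow> dist (f (c *\<^sub>R x)) (f (c *\<^sub>R y)) = dist (c *\<^sub>R x) (c *\<^sub>R y)"
    using sim unfolding similar_lattices_def isometric_sets_def by auto
  have L: "L = lattice_gen a b" using basis by (simp add: lattice_basis_def)
  obtain d e where L'_gen: "L' = lattice_gen d e"
    using L' by (auto simp: planar_lattice_def lattice_basis_def)
  define g where "g x = f (c *\<^sub>R x) - f 0" for x
  have zero: "0 \<in> L" and ab: "a \<in> L" "b \<in> L"
    by (simp_all add: L zero_in_lattice_gen generators_in_lattice_gen)
  have norm_g: "norm (g x - g y) = c * norm (x - y)" if "x \<in> L" "y \<in> L" for x y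
    using iso[OF that] c by (simp add: g_def dist_norm flip: scaleR_diff_right)
  have "g 0 = 0" by (simp add: g_def)
  then have norm_g0: "norm (g x) = c * norm x" if "x \<in> L" for x
    using norm_g[OF that zero] by simp
  have inner_g: "g x \<bullet> g y = c\<^sup>2 * (x \<bullet> y)" if "x \<in> L" "y \<in> L" for x y
  proof -
    have "2 * (g x \<bullet> g y) = (norm (g x))\<^sup>2 + (norm (g y))\<^sup>2 - (norm (g x - g y))\<^sup>2"
      by (simp add: power2_norm_eq_inner inner_diff inner_commute algebra_simps)
    also have "\<dots> = c\<^sup>2 * ((norm x)\<^sup>2 + (norm y)\<^sup>2 - (norm (x - y))\<^sup>2)"
      using that by (simp add: norm_g norm_g0 power_mult_distrib algebra_simps)
    also have "(norm x)\<^sup>2 + (norm y)\<^sup>2 - (norm (x - y))\<^sup>2 = 2 * (x \<bullet> y)"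
      by (simp add: power2_norm_eq_inner inner_diff inner_commute algebra_simps)
    finally show ?thesis by simp
  qed
  have lin: "g (of_int m *\<^sub>R a + of_int n *\<^sub>R b) = of_int m *\<^sub>R g a + of_int n *\<^sub>R g b" for m n :: int
  proof -
    define x where "x = of_int m *\<^sub>R a + of_int n *\<^sub>R b"
    have x: "x \<in> L" by (auto simp: L lattice_gen_iff x_def)
    let ?d = "g x - (of_int m *\<^sub>R g a + of_int n *\<^sub>R g b)"
    have "?d \<bullet> ?d = c\<^sup>2 * ((x - (of_int m *\<^sub>R a + of_int n *\<^sub>R b)) \<bullet> (x - (of_int m *\<^sub>R a + of_int n *\<^sub>R b)))"
      by (simp add: inner_diff inner_add inner_g x ab algebra_simps)
    also have "\<dots> = 0" by (simp add: x_def)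
    finally show ?thesis by (simp add: x_def)
  qed
  have f_L': "f (c *\<^sub>R x) \<in> L'" if "x \<in> L" for x using img that by auto
  have f0: "f 0 \<in> L'" using f_L'[OF zero] by simp
  have "L' = lattice_gen (g a) (g b)"
  proof (intro set_eqI iffI)
    fix y assume "y \<in> L'"
    \<comment> \<open>Since \<open>g\<close> is \<open>f\<close> (after scaling) shifted by
      \<open>- f 0\<close>, a preimage of \<open>y\<close> under \<open>g\<close> comes from a
      preimage of \<open>y + f 0\<close> under \<open>f\<close>.\<close>
    then have "y + f 0 \<in> L'" using f0 by (simp add: L'_gen lattice_gen_add)
    then obtain x where x: "x \<in> L" "y + f 0 = f (c *\<^sub>R x)" using img by auto
    then have "y = g x" by (simp add: g_def algebra_simps)
    then show "y \<in> lattice_gen (g a) (g b)" using x(1) lin by (auto simp: L lattice_gen_iff)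
  next
    fix y assume "y \<in> lattice_gen (g a) (g b)"
    then obtain m n where y: "y = g (of_int m *\<^sub>R a + of_int n *\<^sub>R b)" by (auto simp: lattice_gen_iff lin)
    have "of_int m *\<^sub>R a + of_int n *\<^sub>R b \<in> L" by (auto simp: L lattice_gen_iff)
    then show "y \<in> L'"
      unfolding y g_def using f_L' f0 by (simp add: L'_gen lattice_gen_diff)
  qed
  moreover have "(cross2 (g a) (g b))\<^sup>2 = (c\<^sup>2 * cross2 a b)\<^sup>2"
    unfolding power_mult_distrib cross2_square inner_g[OF ab(1) ab(1)] inner_g[OF ab(1) ab(2)] inner_g[OF ab(2) ab(2)]
    by (simp add: power2_eq_square algebra_simps)
  then have "cross2 (g a) (g b) \<noteq> 0"
    using c lattice_basis_cross2[OF basis] by auto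
  ultimately have "lattice_basis (g a) (g b) L'" using lattice_basisI by simp
  then show ?thesis using that[OF c] inner_g ab by blast
qed

section \<open>Transfer of rational norm-one elements into a lattice\<close>

lemma rat_common_denominator:
  fixes S :: "rat set"
  assumes "finite S"
  obtains D :: int where "0 < D" "\<And>q. q \<in> S \<Longrightarrow> of_int D * q \<in> \<int>"
proof -
  have "\<exists>D::int. 0 < D \<and> (\<forall>q\<in>S. of_int D * q \<in> \<int>)"
    using assms
  proof (induction S rule: finite_induct)
    case empty
    then show ?case by (auto intro: exI[of _ 1])
  next
    case (insert q S)
    then obtain D :: int where D: "0 < D" "\<And>q. q \<in> S \<Longrightarrow> of_int D * q \<in> \<int>" by auto
    obtain n d where q: "q = of_int n / of_int d" "0 < d"
      by (metis prod.exhaust quotient_of_denom_pos quotient_of_div)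
    have "of_int (d * D) * x \<in> \<int>" if "x \<in> insert q S" for x
    proof (cases "x = q")
      case True
      then have "of_int d * x = of_int n" using q by simp
      then have "of_int (d * D) * x = of_int (D * n)" by (simp add: mult.commute mult.left_commute)
      then show ?thesis by (metis Ints_of_int)
    next
      case False
      then have "of_int d * (of_int D * x) \<in> \<int>"
        using that False D(2) Ints_mult[OF Ints_of_int] by blast
      then show ?thesis by (simp add: mult.assoc)
    qed
    then show ?case using D(1) q(2) by (intro exI[of _ "d * D"]) auto
  qed
  then show ?thesis using that by auto
qed

text \<open>The map \<open>(p, q) \<mapsto> (K p - B q) a + A q b\<close> multiplies the norm form
  \<open>p\<^sup>2 + \<nu> q\<^sup>2\<close> by a constant.\<close>
lemma convex_equilateral_gon_of_unit_config:
  fixes A B C K :: int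
  assumes basis: "lattice_basis a b L" and c: "0 < c"
    and gram: "c\<^sup>2 * (a \<bullet> a) = of_int A" "c\<^sup>2 * (a \<bullet> b) = of_int B" "c\<^sup>2 * (b \<bullet> b) = of_int C"
    and disc: "A * C - B\<^sup>2 = K\<^sup>2 * int \<nu>" and \<nu>: "0 < \<nu>"
    and config: "unit_config \<nu> k" and k: "3 \<le> k"
  shows "contains_convex_equilateral_gon L k"
proof -
  obtain V :: "(rat \<times> rat) set" where V: "finite V" "card V = k"
      "\<And>v. v \<in> V \<Longrightarrow> (fst v)\<^sup>2 + of_nat \<nu> * (snd v)\<^sup>2 = 1" "sum fst V = 0" "sum snd V = 0"
    using config by (fastforce simp: unit_config_def)
  obtain D :: int where D: "0 < D" "\<And>q. q \<in> fst ` V \<union> snd ` V \<Longrightarrow> of_int D * q \<in> \<int>"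
    using rat_common_denominator[of "fst ` V \<union> snd ` V"] V(1) by auto
  have L: "L = lattice_gen a b" using basis by (simp add: lattice_basis_def)
  have cr: "cross2 a b \<noteq> 0" using basis by (rule lattice_basis_cross2)
  then have "0 < a \<bullet> a" by (auto simp: inner_gt_zero_iff)
  then have A: "0 < A" using gram(1) c by (metis of_int_0_less_iff zero_less_mult_iff zero_less_power)
  have "(c\<^sup>2 * cross2 a b)\<^sup>2 = of_int (A * C - B\<^sup>2)"
    by (simp add: power_mult_distrib cross2_square flip: gram) (simp add: power2_eq_square power4_eq_xxxx algebra_simps)
  then have K: "K \<noteq> 0" using cr c disc by auto
  \<comment> \<open>Up to the factor \<open>A * K\<close>, the inverse of completing the square: for
    m = K p - B q and l = A q one has A m + B l = A K p and K l = A K q.\<close>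
  define h :: "real \<Rightarrow> real \<Rightarrow> real^2"
    where "h p q = (of_int K * p - of_int B * q) *\<^sub>R a + (of_int A * q) *\<^sub>R b" for p q
  have norm_h: "c\<^sup>2 * (norm (h p q))\<^sup>2 = of_int (A * K\<^sup>2) * (p\<^sup>2 + of_nat \<nu> * q\<^sup>2)" for p q
  proof -
    have disc': "of_int A * of_int C = (of_int B)\<^sup>2 + (of_int K)\<^sup>2 * real \<nu>"
      using arg_cong[OF disc, of "of_int :: int \<Rightarrow> real"] by simp
    let ?u = "of_int K * p - of_int B * q"
    have "c\<^sup>2 * (norm (h p q))\<^sup>2 = ?u\<^sup>2 * (c\<^sup>2 * (a \<bullet> a)) + 2 * ?u * (of_int A * q) * (c\<^sup>2 * (a \<bullet> b))
        + (of_int A * q)\<^sup>2 * (c\<^sup>2 * (b \<bullet> b))"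
      unfolding power2_norm_eq_inner h_def
      by (simp add: inner_add inner_commute power2_eq_square algebra_simps)
    also have "\<dots> = of_int A * ((of_int K * p)\<^sup>2 - (of_int B * q)\<^sup>2 + (of_int A * of_int C) * q\<^sup>2)"
      unfolding gram by (simp add: power2_eq_square algebra_simps)
    also have "\<dots> = of_int (A * K\<^sup>2) * (p\<^sup>2 + of_nat \<nu> * q\<^sup>2)"
      unfolding disc' by (simp add: power2_eq_square algebra_simps)
    finally show ?thesis .
  qed
  have h_diff: "h p q - h p' q' = h (p - p') (q - q')" for p q p' q'
    by (simp add: h_def algebra_simps)
  have h_0: "p = 0 \<and> q = 0" if "h p q = 0" for p q
  proof -
    have "p\<^sup>2 + of_nat \<nu> * q\<^sup>2 = 0" using norm_h[of p q] that A K by simp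
    then show ?thesis using \<nu> by (simp add: add_nonneg_eq_0_iff)
  qed
  define g :: "rat \<times> rat \<Rightarrow> real^2"
    where "g v = h (of_int D * of_rat (fst v)) (of_int D * of_rat (snd v))" for v
  have inj: "inj_on g V"
  proof (rule inj_onI)
    fix v w assume "g v = g w"
    then have "of_int D * of_rat (fst v) - of_int D * of_rat (fst w) = (0::real) \<and>
        of_int D * of_rat (snd v) - of_int D * of_rat (snd w) = (0::real)"
      by (intro h_0) (simp add: g_def flip: h_diff)
    then show "v = w" using D(1) by (simp add: prod_eq_iff)
  qed
  have g_L: "g v \<in> L" if "v \<in> V" for v
  proof -
    have "of_int D * fst v \<in> \<int>" "of_int D * snd v \<in> \<int>" using D(2) that by blast+
    then obtain x y :: int where xy: "of_int D * fst v = of_int x" "of_int D * snd v = of_int y"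
      by (auto elim!: Ints_cases)
    have "of_int D * of_rat (fst v) = real_of_int x" "of_int D * of_rat (snd v) = real_of_int y"
      using arg_cong[OF xy(1), of "of_rat :: rat \<Rightarrow> real"] arg_cong[OF xy(2), of "of_rat :: rat \<Rightarrow> real"]
      by (simp_all add: of_rat_mult)
    then have "g v = of_int (K * x - B * y) *\<^sub>R a + of_int (A * y) *\<^sub>R b"
      by (simp add: g_def h_def)
    then show ?thesis unfolding L lattice_gen_iff by blast
  qed
  \<comment> \<open>The factor \<open>D\<close> gives the cleared points norm
    \<open>D\<^sup>2\<close>, and \<open>norm_h\<close> multiplies it by
    \<open>A * K\<^sup>2\<close>; dividing by \<open>c\<close> undoes the rescaling of the Gram
    matrix.\<close>
  define r where "r = sqrt (of_int (A * K\<^sup>2 * D\<^sup>2)) / c"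
  have r: "0 < r" unfolding r_def using A K D c by (intro divide_pos_pos) auto
  have norm_g: "norm (g v) = r" if "v \<in> V" for v
  proof -
    have "of_rat ((fst v)\<^sup>2 + of_nat \<nu> * (snd v)\<^sup>2) = (1::real)" using V(3)[OF that] by simp
    then have unit: "(of_rat (fst v))\<^sup>2 + of_nat \<nu> * (of_rat (snd v))\<^sup>2 = (1::real)"
      by (simp add: of_rat_add of_rat_mult of_rat_power)
    have "c\<^sup>2 * (norm (g v))\<^sup>2
        = of_int (A * K\<^sup>2 * D\<^sup>2) * ((of_rat (fst v))\<^sup>2 + of_nat \<nu> * (of_rat (snd v))\<^sup>2)"
      by (simp add: g_def norm_h power_mult_distrib algebra_simps)
    then have "(c * norm (g v))\<^sup>2 = of_int (A * K\<^sup>2 * D\<^sup>2)"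
      unfolding unit by (simp add: power_mult_distrib)
    then have "c * norm (g v) = sqrt (of_int (A * K\<^sup>2 * D\<^sup>2))"
      using c by (intro real_sqrt_unique[symmetric]) auto
    then show ?thesis using c by (simp add: r_def field_simps)
  qed
  have "(\<Sum>v\<in>V. g v) = h (of_int D * of_rat (sum fst V)) (of_int D * of_rat (sum snd V))"
    by (simp add: g_def h_def of_rat_sum sum.distrib sum_subtractf sum_distrib_left
        scaleR_sum_left[symmetric] algebra_simps)
  then have "(\<Sum>v\<in>V. g v) = 0" using V by (simp add: h_def)
  then have sum0: "\<Sum>(g ` V) = 0" by (simp add: sum.reindex[OF inj])
  show ?thesis
  proof (rule convex_equilateral_gon_of_vectors[OF _ k r _ sum0])
    show "card (g ` V) = k" using V by (simp add: card_image[OF inj])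
    show "0 \<in> L" by (simp add: L zero_in_lattice_gen)
    show "x + v \<in> L" if "x \<in> L" "v \<in> g ` V" for x v
      using that g_L by (auto simp: L lattice_gen_add)
  qed (use norm_g in auto)
qed

section \<open>Arithmetic obstructions\<close>

lemma odd_sum_of_odd:
  fixes f :: "nat \<Rightarrow> int"
  assumes "odd n" "\<And>i. i < n \<Longrightarrow> odd (f i)"
  shows "odd (\<Sum>i<n. f i)"
proof -
  have "{a \<in> {..<n}. odd (f a)} = {..<n}" using assms(2) by auto
  then show ?thesis using assms(1) by (simp add: even_sum_iff)
qed

text \<open>The necessary conditions after clearing denominators: elements x_i + y_i sqrt(-\<nu>) of
  one common norm \<open>N\<close> and with sum 0. Repetitions are allowed, since sides of a
  non-convex polygon may be equal vectors.\<close>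

definition balanced :: "nat \<Rightarrow> nat \<Rightarrow> int \<Rightarrow> (nat \<Rightarrow> int) \<Rightarrow> (nat \<Rightarrow> int) \<Rightarrow> bool" where
  "balanced \<nu> n N x y \<longleftrightarrow> (\<forall>i<n. (x i)\<^sup>2 + int \<nu> * (y i)\<^sup>2 = N) \<and>
     (\<Sum>i<n. x i) = 0 \<and> (\<Sum>i<n. y i) = 0"

text \<open>Infinite descent in place of choosing a primitive solution: dividing all coordinates by
  \<open>q\<close> divides \<open>N\<close> by \<open>q\<^sup>2\<close> and keeps the family
  balanced. The divisibility is assumed for every balanced family so that it can be applied again to
  the quotient.\<close>

lemma balanced_descent:
  assumes q: "1 < q" and n: "0 < n"
    and step: "\<And>N x y. balanced \<nu> n N x y \<Longrightarrow> \<forall>i<n. q dvd x i \<and> q dvd y i"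
    and bal: "balanced \<nu> n N x y"
  shows "N = 0"
  using bal
proof (induction "nat \<bar>N\<bar>" arbitrary: N x y rule: less_induct)
  case less
  define x' where "x' i = x i div q" for i
  define y' where "y' i = y i div q" for i
  have xy: "x i = q * x' i" "y i = q * y' i" if "i < n" for i
    using step[OF less.prems] that by (simp_all add: x'_def y'_def)
  define N' where "N' = (x' 0)\<^sup>2 + int \<nu> * (y' 0)\<^sup>2"
  have eq: "q\<^sup>2 * ((x' i)\<^sup>2 + int \<nu> * (y' i)\<^sup>2) = N" if "i < n" for i
    using less.prems that by (auto simp: balanced_def xy power_mult_distrib algebra_simps)
  then have N: "N = q\<^sup>2 * N'" using n by (simp add: N'_def)
  have "balanced \<nu> n N' x' y'"
  proof -
    have "(x' i)\<^sup>2 + int \<nu> * (y' i)\<^sup>2 = N'" if "i < n" for i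
      using eq[OF that] q by (simp add: N)
    moreover have "q * (\<Sum>i<n. x' i) = 0" "q * (\<Sum>i<n. y' i) = 0"
      using less.prems by (simp_all add: balanced_def sum_distrib_left flip: xy)
    ultimately show ?thesis using q by (simp add: balanced_def)
  qed
  show "N = 0"
  proof (rule ccontr)
    assume "N \<noteq> 0"
    then have "N' \<noteq> 0" by (auto simp: N)
    have "1 < q\<^sup>2" using q by (simp add: power2_eq_square less_1_mult)
    then have "\<bar>N'\<bar> < \<bar>N\<bar>" using \<open>N' \<noteq> 0\<close> by (simp add: N abs_mult)
    then have "nat \<bar>N'\<bar> < nat \<bar>N\<bar>" by linarith
    then show False using less.hyps \<open>balanced \<nu> n N' x' y'\<close> \<open>N' \<noteq> 0\<close> by blast
  qed
qed

text \<open>Squares are 0 or 1 modulo 4, so unless 4 divides \<open>N\<close>, the residue of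
  \<open>N\<close> makes one of x_i, y_i, x_i + y_i odd for all \<open>i\<close> at once, and an odd
  number of odd terms cannot sum to 0. If 4 divides \<open>N\<close>, all coordinates are even. For
  \<nu> = 3 modulo 4 this last conclusion breaks down: odd x_i and y_i also give norm 0 modulo
  4.\<close>

lemma balanced_even:
  assumes n: "odd n" and \<nu>: "\<nu> mod 4 = 1 \<or> \<nu> mod 4 = 2" and bal: "balanced \<nu> n N x y"
  shows "\<forall>i<n. 2 dvd x i \<and> 2 dvd y i"
proof -
  have sums: "(\<Sum>i<n. x i) = 0" "(\<Sum>i<n. y i) = 0" "(\<Sum>i<n. x i + y i) = 0"
    and norm: "\<And>i. i < n \<Longrightarrow> (x i)\<^sup>2 + int \<nu> * (y i)\<^sup>2 = N"
    using bal by (simp_all add: balanced_def sum.distrib)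
  have par: "\<not> (\<forall>i<n. odd (x i))" "\<not> (\<forall>i<n. odd (y i))" "\<not> (\<forall>i<n. odd (x i + y i))"
    using odd_sum_of_odd[OF n, of x] odd_sum_of_odd[OF n, of y] odd_sum_of_odd[OF n, of "\<lambda>i. x i + y i"]
    unfolding sums by blast+
  have sq: "z\<^sup>2 mod 4 = (if even z then 0 else 1)" for z :: int
  proof -
    have "z\<^sup>2 mod 4 = (z mod 4)\<^sup>2 mod 4" by (simp add: power_mod)
    moreover have "z mod 4 = (if even z then 0 else 1) \<or> z mod 4 = (if even z then 2 else 3)"
      by simp presburger
    ultimately show ?thesis by auto
  qed
  have mod: "((x i)\<^sup>2 mod 4 + (int \<nu> mod 4) * ((y i)\<^sup>2 mod 4)) mod 4 = N mod 4" if "i < n" for i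
    unfolding norm[OF that, symmetric] cong_def[symmetric]
    by (intro cong_add cong_mult) (simp_all add: cong_def)
  have int\<nu>: "int \<nu> mod 4 = int (\<nu> mod 4)" by (simp add: zmod_int)
  show ?thesis
    using \<nu>
  proof
    assume \<nu>: "\<nu> mod 4 = 1"
    have res: "(N mod 4 = 0 \<and> even (x i) \<and> even (y i)) \<or> (N mod 4 = 1 \<and> odd (x i + y i)) \<or>
        (N mod 4 = 2 \<and> odd (x i))" if "i < n" for i
      using mod[OF that] unfolding int\<nu> \<nu> sq by (auto split: if_splits)
    consider "N mod 4 = 1" | "N mod 4 = 2" | "N mod 4 \<noteq> 1 \<and> N mod 4 \<noteq> 2" by blast
    then show ?thesis
    proof cases
      case 1
      then have "\<forall>i<n. odd (x i + y i)" using res by auto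
      then show ?thesis using par by blast
    next
      case 2
      then have "\<forall>i<n. odd (x i)" using res by auto
      then show ?thesis using par by blast
    qed (use res in blast)
  next
    assume \<nu>: "\<nu> mod 4 = 2"
    have res: "(N mod 4 = 0 \<and> even (x i) \<and> even (y i)) \<or> (odd (N mod 4) \<and> odd (x i)) \<or>
        (N mod 4 = 2 \<and> odd (y i))" if "i < n" for i
      using mod[OF that] unfolding int\<nu> \<nu> sq by (auto split: if_splits)
    consider "odd (N mod 4)" | "N mod 4 = 2" | "even (N mod 4) \<and> N mod 4 \<noteq> 2" by blast
    then show ?thesis
    proof cases
      case 1
      then have "\<forall>i<n. odd (x i)" using res by fastforce
      then show ?thesis using par by blast
    next
      case 2
      then have "\<forall>i<n. odd (y i)" using res by auto
      then show ?thesis using par by blast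
    qed (use res in blast)
  qed
qed

text \<open>All \<open>z i\<close> are \<open>\<plusminus> z 0\<close> modulo \<open>p\<close>, and an odd number \<open>n < p\<close> of signs has a sum
  that is nonzero modulo \<open>p\<close>.\<close>
lemma prime_dvd_of_equal_squares:
  fixes z :: "nat \<Rightarrow> int"
  assumes p: "prime p" and n: "odd n" "n < p"
    and sq: "\<And>i. i < n \<Longrightarrow> int p dvd (z i)\<^sup>2 - (z 0)\<^sup>2" and sum0: "int p dvd (\<Sum>i<n. z i)"
  shows "\<forall>i<n. int p dvd z i"
proof -
  have pp: "prime (int p)" using p by simp
  have "\<exists>e. (e = 1 \<or> e = -1) \<and> int p dvd z i - e * z 0" if "i < n" for i
  proof -
    have "int p dvd (z i - z 0) * (z i + z 0)"
      using sq[OF that] by (simp add: power2_eq_square algebra_simps)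
    then consider "int p dvd z i - z 0" | "int p dvd z i + z 0"
      using pp by (auto simp: prime_dvd_mult_iff)
    then show ?thesis
      by cases (auto intro: exI[of _ "1"] exI[of _ "-1"])
  qed
  then obtain e where e: "\<And>i. i < n \<Longrightarrow> e i = (1::int) \<or> e i = -1"
      "\<And>i. i < n \<Longrightarrow> int p dvd z i - e i * z 0"
    by metis
  have "int p dvd (\<Sum>i<n. z i - e i * z 0)" using e(2) by (intro dvd_sum) auto
  then have "int p dvd (\<Sum>i<n. z i) - (\<Sum>i<n. e i) * z 0"
    by (simp add: sum_subtractf sum_distrib_right)
  then have "int p dvd (\<Sum>i<n. e i) * z 0" using sum0 by (simp add: dvd_diff_right_iff dvd_diff_left_iff)
  moreover have "\<not> int p dvd (\<Sum>i<n. e i)"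
  proof
    have "odd (\<Sum>i<n. e i)" using e(1) by (intro odd_sum_of_odd n) fastforce
    then have ne: "(\<Sum>i<n. e i) \<noteq> 0" by auto
    have "\<bar>\<Sum>i<n. e i\<bar> \<le> (\<Sum>i<n. \<bar>e i\<bar>)" by (rule sum_abs)
    also have "\<dots> \<le> (\<Sum>i<n. 1)" using e(1) by (intro sum_mono) fastforce
    also have "\<dots> < int p" using n by simp
    finally have "\<bar>\<Sum>i<n. e i\<bar> < int p" .
    moreover assume "int p dvd (\<Sum>i<n. e i)"
    ultimately show False using ne by (meson dvd_imp_le_int linorder_not_less order.strict_trans2 abs_ge_self dvd_abs_iff zdvd_not_zless zero_less_abs_iff)
  qed
  ultimately have p0: "int p dvd z 0" using pp by (simp add: prime_dvd_mult_iff)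
  show ?thesis
  proof (intro allI impI)
    fix i assume "i < n"
    then have "int p dvd (z i - e i * z 0) + e i * z 0" using e(2) p0 by (intro dvd_add) auto
    then show "int p dvd z i" by simp
  qed
qed

text \<open>Modulo \<open>p\<close> all squares of the x_i agree, so \<open>p\<close> divides every
  x_i. Then \<open>p\<^sup>2\<close> divides their squares, while square-freeness puts
  \<open>p\<close> only once into \<nu>; cancelling one \<open>p\<close> from the norm equations
  shows that the squares of the y_i agree modulo \<open>p\<close> too, and the same argument
  repeats.\<close>

lemma balanced_prime_dvd:
  assumes n: "odd n" "n < p" and p: "prime p" "p dvd \<nu>" and sf: "squarefree \<nu>"
    and bal: "balanced \<nu> n N x y"
  shows "\<forall>i<n. int p dvd x i \<and> int p dvd y i"
proof -
  have n0: "0 < n" using n by (auto intro: odd_pos)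
  have sums: "(\<Sum>i<n. x i) = 0" "(\<Sum>i<n. y i) = 0"
    and norm: "\<And>i. i < n \<Longrightarrow> (x i)\<^sup>2 + int \<nu> * (y i)\<^sup>2 = N"
    using bal by (simp_all add: balanced_def)
  have pp: "prime (int p)" using p by simp
  obtain m where m: "\<nu> = p * m" using p(2) by auto
  have "\<not> p dvd m"
  proof
    assume "p dvd m"
    then have "p\<^sup>2 dvd \<nu>" by (auto simp: m power2_eq_square)
    then show False using sf p(1) by (auto simp: squarefree_def dest: not_prime_unit)
  qed
  then have m': "\<not> int p dvd int m" by simp
  have px: "\<forall>i<n. int p dvd x i"
  proof (rule prime_dvd_of_equal_squares[OF p(1) n])
    fix i assume "i < n"
    then have "(x i)\<^sup>2 - (x 0)\<^sup>2 = int p * (int m * ((y 0)\<^sup>2 - (y i)\<^sup>2))"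
      using norm[of i] norm[OF n0] by (simp add: m algebra_simps)
    then show "int p dvd (x i)\<^sup>2 - (x 0)\<^sup>2" by simp
  qed (simp add: sums)
  have "\<forall>i<n. int p dvd y i"
  proof (rule prime_dvd_of_equal_squares[OF p(1) n])
    fix i assume i: "i < n"
    have "int p dvd x i" "int p dvd x 0" using px i n0 by simp_all
    then obtain u v where uv: "x i = int p * u" "x 0 = int p * v" by (elim dvdE)
    have "int p * (int m * ((y i)\<^sup>2 - (y 0)\<^sup>2)) = int p * (int p * (v\<^sup>2 - u\<^sup>2))"
      using norm[OF i] norm[OF n0] uv by (simp add: m power2_eq_square algebra_simps)
    then have "int m * ((y i)\<^sup>2 - (y 0)\<^sup>2) = int p * (v\<^sup>2 - u\<^sup>2)"
      using p(1) by (auto dest: prime_gt_0_nat)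
    then have "int p dvd int m * ((y i)\<^sup>2 - (y 0)\<^sup>2)" by simp
    then show "int p dvd (y i)\<^sup>2 - (y 0)\<^sup>2" using pp m' by (simp add: prime_dvd_mult_iff)
  qed (simp add: sums)
  then show ?thesis using px by simp
qed

lemma balanced_imp:
  assumes n: "odd n" and sf: "squarefree \<nu>" and bal: "balanced \<nu> n N x y" and N: "N \<noteq> 0"
  shows "[\<nu> = 3] (mod 4)" and "prime p \<Longrightarrow> p dvd \<nu> \<Longrightarrow> p \<le> n"
proof -
  have n0: "0 < n" using n by (auto intro: odd_pos)
  have "\<nu> mod 4 \<noteq> 0"
  proof
    assume "\<nu> mod 4 = 0"
    then have "2\<^sup>2 dvd \<nu>" by (simp add: mod_eq_0_iff_dvd)
    from squarefreeD[OF sf this] show False by simp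
  qed
  moreover have "\<not> (\<nu> mod 4 = 1 \<or> \<nu> mod 4 = 2)"
  proof
    assume \<nu>: "\<nu> mod 4 = 1 \<or> \<nu> mod 4 = 2"
    have "N = 0" by (rule balanced_descent[OF _ n0 balanced_even[OF n \<nu>] bal]) simp
    then show False using N by simp
  qed
  ultimately show "[\<nu> = 3] (mod 4)" unfolding cong_def by presburger
next
  assume p: "prime p" "p dvd \<nu>"
  have n0: "0 < n" using n by (auto intro: odd_pos)
  show "p \<le> n"
  proof (rule ccontr)
    assume "\<not> p \<le> n"
    then have less: "n < p" by simp
    have "N = 0"
      by (rule balanced_descent[OF _ n0 balanced_prime_dvd[OF n less p sf] bal])
        (use prime_gt_1_nat[OF p(1)] in simp)
    then show False using N by simp
  qed
qed

section \<open>The equivalence\<close>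

text \<open>The arithmetic is carried by the side vectors. Independence of the basis splits their
  closing relation into two integer equations, and distinctness of the vertices makes the common
  length positive.\<close>

lemma equilateral_gon_coordinates:
  assumes basis: "lattice_basis a b L" and gon: "contains_equilateral_gon L n"
  obtains m l :: "nat \<Rightarrow> int" and s :: real where "0 < s"
    "\<And>i. i < n \<Longrightarrow> norm (of_int (m i) *\<^sub>R a + of_int (l i) *\<^sub>R b) = s"
    "(\<Sum>i<n. m i) = 0" "(\<Sum>i<n. l i) = 0"
proof -
  have L: "L = lattice_gen a b" using basis by (simp add: lattice_basis_def)
  obtain vs s where len: "length vs = n" and poly: "polygon vs" and vs: "set vs \<subseteq> L"
    and s: "\<And>i. i < n \<Longrightarrow> dist (vs ! i) (vs ! (Suc i mod n)) = s"
    using gon by (auto simp: contains_equilateral_gon_def equilateral_def)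
  have n3: "3 \<le> n" and dist: "distinct vs" using poly len by (auto simp: polygon_def Let_def)
  define f where "f i = vs ! (i mod n)" for i
  have f_L: "f i \<in> lattice_gen a b" for i
  proof -
    have "i mod n < length vs" using len n3 by simp
    then have "f i \<in> set vs" unfolding f_def by (rule nth_mem)
    then show ?thesis using vs by (auto simp: L)
  qed
  have "\<exists>m l. f (Suc i) - f i = of_int m *\<^sub>R a + of_int l *\<^sub>R b" for i
    using lattice_gen_diff[OF f_L[of "Suc i"] f_L[of i]] by (simp add: lattice_gen_iff)
  then obtain m l :: "nat \<Rightarrow> int"
    where ml: "\<And>i. f (Suc i) - f i = of_int (m i) *\<^sub>R a + of_int (l i) *\<^sub>R b"
    by metis
  have norm: "norm (of_int (m i) *\<^sub>R a + of_int (l i) *\<^sub>R b) = s" if "i < n" for i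
    using s[OF that] that by (simp add: f_def dist_norm norm_minus_commute flip: ml)
  have "vs ! 0 \<noteq> vs ! 1" using dist len n3 by (simp add: nth_eq_iff_index_eq)
  then have s0: "0 < s" using s[of 0] n3 by auto
  have "(\<Sum>i<n. f (Suc i) - f i) = 0"
    unfolding sum_lessThan_telescope by (simp add: f_def)
  then have "of_int (\<Sum>i<n. m i) *\<^sub>R a + of_int (\<Sum>i<n. l i) *\<^sub>R b = 0"
    by (simp add: ml sum.distrib scaleR_sum_left)
  from cross2_independent[OF lattice_basis_cross2[OF basis] this]
  have "(\<Sum>i<n. m i) = 0" "(\<Sum>i<n. l i) = 0" by linarith+
  then show ?thesis using that s0 norm by blast
qed

text \<open>The equality case of Cauchy-Schwarz, read off from Lagrange's identity.\<close>

lemma parallel_equal_norm: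
  fixes v w :: "real^2"
  assumes "norm v = norm w" "cross2 v w = 0"
  shows "w = v \<or> w = - v"
proof -
  have "(v \<bullet> w)\<^sup>2 = (v \<bullet> v)\<^sup>2"
    using cross2_square[of v w] assms by (simp add: norm_eq power2_eq_square)
  moreover have ww: "w \<bullet> w = v \<bullet> v" using assms(1) by (simp add: norm_eq)
  ultimately consider "v \<bullet> w = v \<bullet> v" | "v \<bullet> w = - (v \<bullet> v)" by (auto simp: power2_eq_iff)
  then show ?thesis
  proof cases
    case 1
    have "(w - v) \<bullet> (w - v) = w \<bullet> w - 2 * (v \<bullet> w) + v \<bullet> v"
      by (simp add: inner_diff inner_commute)
    then have "(w - v) \<bullet> (w - v) = 0" using 1 ww by simp
    then show ?thesis by simp
  next
    case 2
    have "(w + v) \<bullet> (w + v) = w \<bullet> w + 2 * (v \<bullet> w) + v \<bullet> v"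
      by (simp add: inner_add inner_commute)
    then have "(w + v) \<bullet> (w + v) = 0" using 2 ww by simp
    then have "w + v = 0" by (simp only: inner_eq_zero_iff)
    then show ?thesis by (simp add: add_eq_0_iff2)
  qed
qed

text \<open>In the basis \<open>v\<close>, \<open>w\<close> each term has coordinate sum 1 or -1. An
  odd number of these adds up to an odd integer, whereas the zero vector has coordinate sum
  0.\<close>

lemma odd_sum_in_two_directions:
  fixes v w :: "real^2" and u :: "nat \<Rightarrow> real^2"
  assumes n: "odd n" and indep: "cross2 v w \<noteq> 0" and sum0: "(\<Sum>i<n. u i) = 0"
    and u: "\<And>i. i < n \<Longrightarrow> u i \<in> {v, - v, w, - w}"
  shows False
proof -
  have "\<exists>e f::int. u i = of_int e *\<^sub>R v + of_int f *\<^sub>R w \<and> odd (e + f)" if "i < n" for i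
  proof -
    have "u i = of_int 1 *\<^sub>R v + of_int 0 *\<^sub>R w \<or> u i = of_int (-1) *\<^sub>R v + of_int 0 *\<^sub>R w \<or>
        u i = of_int 0 *\<^sub>R v + of_int 1 *\<^sub>R w \<or> u i = of_int 0 *\<^sub>R v + of_int (-1) *\<^sub>R w"
      using u[OF that] by auto
    moreover have "odd (1 + 0 :: int)" "odd (-1 + 0 :: int)" "odd (0 + 1 :: int)" "odd (0 + -1 :: int)"
      by simp_all
    ultimately show ?thesis by blast
  qed
  then obtain e f :: "nat \<Rightarrow> int" where ef: "\<And>i. i < n \<Longrightarrow> u i = of_int (e i) *\<^sub>R v + of_int (f i) *\<^sub>R w"
      "\<And>i. i < n \<Longrightarrow> odd (e i + f i)"
    by metis
  have "of_int (\<Sum>i<n. e i) *\<^sub>R v + of_int (\<Sum>i<n. f i) *\<^sub>R w = (\<Sum>i<n. u i)"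
    by (simp add: ef sum.distrib scaleR_sum_left)
  then have "(\<Sum>i<n. e i) = 0" "(\<Sum>i<n. f i) = 0"
    using cross2_independent[OF indep, of "of_int (\<Sum>i<n. e i)" "of_int (\<Sum>i<n. f i)"]
    unfolding sum0 by linarith+
  then have "(\<Sum>i<n. e i + f i) = 0" by (simp add: sum.distrib)
  then show False using odd_sum_of_odd[OF n, of "\<lambda>i. e i + f i"] ef(2) by simp
qed

text \<open>Three pairwise non-parallel lattice vectors of equal length determine the Gram matrix
  up to a rational factor.\<close>
lemma rescaled_gram_integral:
  fixes a b :: "real^2" and m l :: "nat \<Rightarrow> int"
  assumes cr: "cross2 a b \<noteq> 0" and n: "odd n" and s: "0 < s"
    and norm: "\<And>i. i < n \<Longrightarrow> norm (of_int (m i) *\<^sub>R a + of_int (l i) *\<^sub>R b) = s"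
    and sums: "(\<Sum>i<n. m i) = 0" "(\<Sum>i<n. l i) = 0"
  obtains c A B C where "0 < c" "c\<^sup>2 * (a \<bullet> a) = of_int A" "c\<^sup>2 * (a \<bullet> b) = of_int B"
    "c\<^sup>2 * (b \<bullet> b) = of_int C" "c\<^sup>2 * s\<^sup>2 \<in> \<int>"
proof -
  define w where "w i = of_int (m i) *\<^sub>R a + of_int (l i) *\<^sub>R b" for i
  have n0: "0 < n" using n by (rule odd_pos)
  have norm_w: "norm (w i) = s" if "i < n" for i using norm[OF that] by (simp add: w_def)
  have "(\<Sum>i<n. w i) = of_int (\<Sum>i<n. m i) *\<^sub>R a + of_int (\<Sum>i<n. l i) *\<^sub>R b"
    by (simp add: w_def sum.distrib scaleR_sum_left)
  then have sum_w: "(\<Sum>i<n. w i) = 0" by (simp add: sums)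
  have par: "w j = w i \<or> w j = - w i" if "i < n" "j < n" "cross2 (w i) (w j) = 0" for i j
    using that by (intro parallel_equal_norm) (simp_all add: norm_w)
  have "\<exists>j<n. cross2 (w 0) (w j) \<noteq> 0"
  proof (rule ccontr)
    assume "\<not> ?thesis"
    then have all: "w i \<in> {w 0, - w 0}" if "i < n" for i using par[OF n0 that] that by blast
    have "w 0 \<noteq> 0" using norm_w[OF n0] s by auto
    \<comment> \<open>\<open>w 0\<close> turned by a right angle, an auxiliary second direction that
      reduces the case of a single direction to \<open>odd_sum_in_two_directions\<close>.\<close>
    moreover define z :: "real^2" where "z = vector [- w 0 $ 2, w 0 $ 1]"
    ultimately have "cross2 (w 0) z \<noteq> 0"
      by (auto simp: cross2_def vec_eq_iff forall_2 add_nonneg_eq_0_iff)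
    then show False using odd_sum_in_two_directions[OF n _ sum_w] all by blast
  qed
  then obtain j where j: "j < n" "cross2 (w 0) (w j) \<noteq> 0" by blast
  have "\<exists>k<n. cross2 (w 0) (w k) \<noteq> 0 \<and> cross2 (w j) (w k) \<noteq> 0"
  proof (rule ccontr)
    assume "\<not> ?thesis"
    then have "w i \<in> {w 0, - w 0, w j, - w j}" if "i < n" for i
      using par[OF n0 that] par[OF j(1) that] that by blast
    then show False using odd_sum_in_two_directions[OF n j(2) sum_w] by blast
  qed
  then obtain k where k: "k < n" "cross2 (w 0) (w k) \<noteq> 0" "cross2 (w j) (w k) \<noteq> 0" by blast
  define d where "d i j = m i * l j - m j * l i" for i j
  have cross_d: "cross2 (w i) (w j) = of_int (d i j) * cross2 a b" for i j
    by (simp add: w_def d_def cross2_def algebra_simps)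
  have nz: "d 0 j \<noteq> 0" "d 0 k \<noteq> 0" "d j k \<noteq> 0"
    using j k by (auto simp: cross_d)
  define G where "G = w 0 \<bullet> w j"
  \<comment> \<open>A common denominator for all entries of the Gram matrix divided by
    \<open>s\<^sup>2\<close>: solving for \<open>G\<close> costs \<open>2 * d j k * d 0 k\<close>,
    and expressing both arguments of an inner product through \<open>w 0\<close> and
    \<open>w j\<close> costs \<open>(d 0 j)\<^sup>2\<close>.\<close>
  define Z where "Z = 2 * d j k * d 0 k * (d 0 j)\<^sup>2"
  \<comment> \<open>The linear relation between three plane vectors, with their determinants as
    coefficients. As all three have length \<open>s\<close>, comparing squared lengths determines
    \<open>G\<close> as a rational multiple of \<open>s\<^sup>2\<close>.\<close>
  have "real_of_int (d 0 j) *\<^sub>R w k = - real_of_int (d j k) *\<^sub>R w 0 + real_of_int (d 0 k) *\<^sub>R w j"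
    by (simp add: w_def d_def algebra_simps)
  then have "(real_of_int (d 0 j) *\<^sub>R w k) \<bullet> (real_of_int (d 0 j) *\<^sub>R w k)
      = (- real_of_int (d j k) *\<^sub>R w 0 + real_of_int (d 0 k) *\<^sub>R w j) \<bullet>
        (- real_of_int (d j k) *\<^sub>R w 0 + real_of_int (d 0 k) *\<^sub>R w j)"
    by simp
  moreover have ww: "w i \<bullet> w i = s\<^sup>2" if "i < n" for i
    using norm_w[OF that] by (simp flip: power2_norm_eq_inner)
  ultimately have "(real_of_int (d 0 j))\<^sup>2 * s\<^sup>2 = (real_of_int (d j k))\<^sup>2 * s\<^sup>2
      - 2 * real_of_int (d j k) * real_of_int (d 0 k) * G + (real_of_int (d 0 k))\<^sup>2 * s\<^sup>2"
    using n0 j(1) k(1)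
    by (simp add: inner_add inner_diff ww G_def inner_commute power2_eq_square algebra_simps)
  then have G: "2 * real_of_int (d j k) * real_of_int (d 0 k) * G
      = s\<^sup>2 * of_int ((d j k)\<^sup>2 + (d 0 k)\<^sup>2 - (d 0 j)\<^sup>2)"
    by (simp add: algebra_simps)
  have ab: "real_of_int (d 0 j) *\<^sub>R a = of_int (l j) *\<^sub>R w 0 - of_int (l 0) *\<^sub>R w j"
    "real_of_int (d 0 j) *\<^sub>R b = - of_int (m j) *\<^sub>R w 0 + of_int (m 0) *\<^sub>R w j"
    by (simp_all add: w_def d_def algebra_simps)
  have comb: "\<exists>I::int. of_int (2 * d j k * d 0 k) * ((of_int p *\<^sub>R w 0 + of_int q *\<^sub>R w j)
      \<bullet> (of_int p' *\<^sub>R w 0 + of_int q' *\<^sub>R w j)) = s\<^sup>2 * of_int I" for p q p' q' :: int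
  proof -
    have "of_int (2 * d j k * d 0 k) * ((of_int p *\<^sub>R w 0 + of_int q *\<^sub>R w j)
        \<bullet> (of_int p' *\<^sub>R w 0 + of_int q' *\<^sub>R w j))
      = s\<^sup>2 * of_int (2 * d j k * d 0 k * (p * p' + q * q'))
        + (2 * real_of_int (d j k) * real_of_int (d 0 k) * G) * of_int (p * q' + q * p')"
      using n0 j(1) by (simp add: inner_add ww inner_commute[of "w j" "w 0"] G_def algebra_simps)
    also have "\<dots> = s\<^sup>2 * of_int (2 * d j k * d 0 k * (p * p' + q * q')
        + ((d j k)\<^sup>2 + (d 0 k)\<^sup>2 - (d 0 j)\<^sup>2) * (p * q' + q * p'))"
      unfolding G by (simp add: algebra_simps)
    finally show ?thesis by blast
  qed
  have gram: "\<exists>I::int. of_int Z * (x \<bullet> y) = s\<^sup>2 * of_int I" if "x \<in> {a, b}" "y \<in> {a, b}" for x y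
  proof -
    have rep: "\<exists>p q. real_of_int (d 0 j) *\<^sub>R x = of_int p *\<^sub>R w 0 + of_int q *\<^sub>R w j" if "x \<in> {a, b}" for x
    proof -
      have "real_of_int (d 0 j) *\<^sub>R a = of_int (l j) *\<^sub>R w 0 + of_int (- l 0) *\<^sub>R w j"
        "real_of_int (d 0 j) *\<^sub>R b = of_int (- m j) *\<^sub>R w 0 + of_int (m 0) *\<^sub>R w j"
        using ab by simp_all
      then show ?thesis using that by blast
    qed
    obtain p q where x: "real_of_int (d 0 j) *\<^sub>R x = of_int p *\<^sub>R w 0 + of_int q *\<^sub>R w j"
      using rep[OF \<open>x \<in> {a, b}\<close>] by blast
    obtain p' q' where y: "real_of_int (d 0 j) *\<^sub>R y = of_int p' *\<^sub>R w 0 + of_int q' *\<^sub>R w j"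
      using rep[OF \<open>y \<in> {a, b}\<close>] by blast
    have "of_int Z * (x \<bullet> y)
        = of_int (2 * d j k * d 0 k) * ((real_of_int (d 0 j) *\<^sub>R x) \<bullet> (real_of_int (d 0 j) *\<^sub>R y))"
      by (simp add: Z_def power2_eq_square)
    then show ?thesis using comb[of p q p' q'] unfolding x y by simp
  qed
  have Z: "Z \<noteq> 0" using nz by (simp add: Z_def)
  \<comment> \<open>Chosen so that \<open>c\<^sup>2 * s\<^sup>2\<close> is the denominator
    \<open>\<bar>Z\<bar>\<close>; the sign of \<open>Z\<close> is unknown and is moved into the
    integer entries through \<open>sgn Z\<close>.\<close>
  define c where "c = sqrt (of_int \<bar>Z\<bar>) / s"
  have c: "0 < c" using Z s by (simp add: c_def)
  have c2: "c\<^sup>2 * s\<^sup>2 = of_int \<bar>Z\<bar>" using s by (simp add: c_def power_divide)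
  have "\<exists>I::int. c\<^sup>2 * (x \<bullet> y) = of_int I" if "x \<in> {a, b}" "y \<in> {a, b}" for x y
  proof -
    obtain I :: int where I: "of_int Z * (x \<bullet> y) = s\<^sup>2 * of_int I"
      using gram[OF \<open>x \<in> {a, b}\<close> \<open>y \<in> {a, b}\<close>] by blast
    have "s\<^sup>2 * (c\<^sup>2 * (x \<bullet> y)) = of_int (sgn Z) * (of_int Z * (x \<bullet> y))"
      using c2 by (simp add: abs_sgn algebra_simps)
    also have "\<dots> = s\<^sup>2 * of_int (sgn Z * I)" by (simp add: I)
    finally have "c\<^sup>2 * (x \<bullet> y) = of_int (sgn Z * I)" using s by simp
    then show ?thesis by blast
  qed
  then obtain A B C where "c\<^sup>2 * (a \<bullet> a) = of_int A" "c\<^sup>2 * (a \<bullet> b) = of_int B"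
    "c\<^sup>2 * (b \<bullet> b) = of_int C"
    by (metis insertCI)
  then show ?thesis using that c c2 by (metis Ints_of_int)
qed

lemma integral_lattice_gen:
  assumes "a \<bullet> a \<in> \<int>" "a \<bullet> b \<in> \<int>" "b \<bullet> b \<in> \<int>"
  shows "integral_lattice (lattice_gen a b)"
  unfolding integral_lattice_def
  using assms by (auto simp: lattice_gen_iff inner_add inner_commute[of b a] intro!: Ints_add Ints_mult)

text \<open>In the rescaled lattice all sides have the same integer norm N. Multiplying by A
  completes the square and uses A C - B^2 = \<kappa>^2 \<nu>, so the pairs (A m_i + B l_i, \<kappa>
  l_i) form a balanced family of nonzero norm A N.\<close>

lemma integral_lattice_of_equilateral_gon:
  assumes basis: "lattice_basis a b L" and n: "odd n" and gon: "contains_equilateral_gon L n"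
  shows "\<exists>L'. planar_lattice L' \<and> integral_lattice L' \<and> similar_lattices L L' \<and>
    [lattice_nu L' = 3] (mod 4) \<and> Max (prime_factors (lattice_nu L')) \<le> n"
proof -
  obtain m l s where s: "0 < s"
    and norm: "\<And>i. i < n \<Longrightarrow> norm (of_int (m i) *\<^sub>R a + of_int (l i) *\<^sub>R b) = s"
    and sums: "(\<Sum>i<n. m i) = 0" "(\<Sum>i<n. l i) = 0"
    using equilateral_gon_coordinates[OF basis gon] by metis
  note cr = lattice_basis_cross2[OF basis]
  obtain c A B C where c: "0 < c" and gram: "c\<^sup>2 * (a \<bullet> a) = of_int A"
    "c\<^sup>2 * (a \<bullet> b) = of_int B" "c\<^sup>2 * (b \<bullet> b) = of_int C" and cs: "c\<^sup>2 * s\<^sup>2 \<in> \<int>"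
    using rescaled_gram_integral[OF cr n s norm sums] by metis
  define L' where "L' = lattice_gen (c *\<^sub>R a) (c *\<^sub>R b)"
  have gram': "(c *\<^sub>R a) \<bullet> (c *\<^sub>R a) = of_int A" "(c *\<^sub>R a) \<bullet> (c *\<^sub>R b) = of_int B"
    "(c *\<^sub>R b) \<bullet> (c *\<^sub>R b) = of_int C"
    using gram by (simp_all add: power2_eq_square mult.assoc)
  have "cross2 (c *\<^sub>R a) (c *\<^sub>R b) \<noteq> 0" using cr c by (simp add: cross2_def flip: mult.assoc right_diff_distrib)
  then have basis': "lattice_basis (c *\<^sub>R a) (c *\<^sub>R b) L'" unfolding L'_def by (rule lattice_basisI)
  then have planar: "planar_lattice L'" by (auto simp: planar_lattice_def)
  have integral: "integral_lattice L'" unfolding L'_def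
    by (intro integral_lattice_gen) (simp_all only: gram' Ints_of_int)
  have "(\<lambda>x. c *\<^sub>R x) ` L = L'"
  proof (intro set_eqI iffI)
    fix x assume "x \<in> (\<lambda>x. c *\<^sub>R x) ` L"
    then obtain y where "y \<in> lattice_gen a b" and x: "x = c *\<^sub>R y"
      using basis by (auto simp: lattice_basis_def)
    then obtain p q where "y = of_int p *\<^sub>R a + of_int q *\<^sub>R b"
      unfolding lattice_gen_iff by blast
    then have "x = of_int p *\<^sub>R (c *\<^sub>R a) + of_int q *\<^sub>R (c *\<^sub>R b)" by (simp add: x algebra_simps)
    then show "x \<in> L'" unfolding L'_def lattice_gen_iff by blast
  next
    fix x assume "x \<in> L'"
    then obtain p q where "x = of_int p *\<^sub>R (c *\<^sub>R a) + of_int q *\<^sub>R (c *\<^sub>R b)"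
      by (auto simp: L'_def lattice_gen_iff)
    then have x: "x = c *\<^sub>R (of_int p *\<^sub>R a + of_int q *\<^sub>R b)" by (simp add: algebra_simps)
    have "of_int p *\<^sub>R a + of_int q *\<^sub>R b \<in> L"
      using basis by (auto simp: lattice_basis_def lattice_gen_iff)
    then show "x \<in> (\<lambda>x. c *\<^sub>R x) ` L" unfolding x by (rule imageI)
  qed
  then have sim: "similar_lattices L L'"
    unfolding similar_lattices_def isometric_sets_def using c
    by (intro exI[of _ c] conjI exI[of _ "\<lambda>x. x"]) auto
  define \<nu> where "\<nu> = lattice_nu L'"
  obtain \<kappa> :: int where sf: "squarefree \<nu>" and \<kappa>: "(lattice_area L')\<^sup>2 = (of_int \<kappa>)\<^sup>2 * of_nat \<nu>"
    using lattice_nu[OF planar integral] by (auto simp: \<nu>_def)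
  have "real_of_int (A * C - B\<^sup>2) = of_int (\<kappa>\<^sup>2 * int \<nu>)"
    using lattice_area_gram[OF basis'] \<kappa> unfolding gram' by simp
  then have disc: "A * C - B\<^sup>2 = \<kappa>\<^sup>2 * int \<nu>" by (simp only: of_int_eq_iff)
  obtain N where N: "c\<^sup>2 * s\<^sup>2 = of_int N" using cs by (auto elim: Ints_cases)
  have N0: "N \<noteq> 0" using N c s by auto
  have "a \<noteq> 0" using cr by auto
  then have A0: "A \<noteq> 0" using gram(1) c by auto
  have form: "A * (m i)\<^sup>2 + 2 * B * m i * l i + C * (l i)\<^sup>2 = N" if "i < n" for i
  proof -
    have "real_of_int N = c\<^sup>2 * (norm (of_int (m i) *\<^sub>R a + of_int (l i) *\<^sub>R b))\<^sup>2"
      using norm[OF that] N by simp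
    also have "\<dots> = (c\<^sup>2 * (a \<bullet> a)) * (of_int (m i))\<^sup>2 + 2 * (c\<^sup>2 * (a \<bullet> b)) * of_int (m i) * of_int (l i)
        + (c\<^sup>2 * (b \<bullet> b)) * (of_int (l i))\<^sup>2"
      unfolding power2_norm_eq_inner
      by (simp add: inner_add inner_commute power2_eq_square algebra_simps)
    also have "\<dots> = of_int (A * (m i)\<^sup>2 + 2 * B * m i * l i + C * (l i)\<^sup>2)"
      unfolding gram by simp
    finally show ?thesis by (simp only: of_int_eq_iff)
  qed
  have "(A * m i + B * l i)\<^sup>2 + int \<nu> * (\<kappa> * l i)\<^sup>2 = A * N" if "i < n" for i
  proof -
    have "(A * m i + B * l i)\<^sup>2 + int \<nu> * (\<kappa> * l i)\<^sup>2
        = (A * m i + B * l i)\<^sup>2 + (\<kappa>\<^sup>2 * int \<nu>) * (l i)\<^sup>2"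
      by (simp add: power_mult_distrib)
    also have "\<dots> = A * (A * (m i)\<^sup>2 + 2 * B * m i * l i + C * (l i)\<^sup>2)"
      unfolding disc[symmetric] by (simp add: power2_eq_square algebra_simps)
    finally show ?thesis using form[OF that] by simp
  qed
  then have bal: "balanced \<nu> n (A * N) (\<lambda>i. A * m i + B * l i) (\<lambda>i. \<kappa> * l i)"
    by (simp add: balanced_def sum.distrib sums flip: sum_distrib_left)
  have AN: "A * N \<noteq> 0" using A0 N0 by simp
  have mod4: "[\<nu> = 3] (mod 4)" by (rule balanced_imp(1)[OF n sf bal AN])
  \<comment> \<open>This makes the set of prime factors nonempty, so that \<open>Max\<close> really
    denotes its largest element.\<close>
  have "\<nu> \<noteq> 0 \<and> \<nu> \<noteq> 1" using mod4 by (auto simp: cong_def)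
  then have "prime_factors \<nu> \<noteq> {}" by (simp add: prime_factorization_empty_iff)
  then have "Max (prime_factors \<nu>) \<in> prime_factors \<nu>" by (intro Max_in) auto
  then have "Max (prime_factors \<nu>) \<le> n"
    using balanced_imp(2)[OF n sf bal AN] by (auto simp: prime_factors_dvd)
  then show ?thesis using planar integral sim mod4 unfolding \<nu>_def by blast
qed

text \<open>The primes of \<nu> are odd and below 17, so \<nu> belongs to the finite list. Its
  largest prime p is odd with p \<le> n \<le> k, hence the known set of size p can be enlarged to
  size \<open>k\<close>. The Gram matrix of \<open>L'\<close> in the basis transported from
  \<open>a\<close>, \<open>b\<close> then carries this set back to \<open>L\<close>.\<close>

lemma convex_gons_of_similar_integral_lattice:
  assumes basis: "lattice_basis a b L" and n: "odd n" "3 \<le> n" "n < 17"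
    and L': "planar_lattice L'" "integral_lattice L'" "similar_lattices L L'"
    and mod4: "[lattice_nu L' = 3] (mod 4)" and max: "Max (prime_factors (lattice_nu L')) \<le> n"
    and k: "n \<le> k"
  shows "contains_convex_equilateral_gon L k"
proof -
  obtain c a' b' where c: "0 < c" and basis': "lattice_basis a' b' L'"
    and gram: "a' \<bullet> a' = c\<^sup>2 * (a \<bullet> a)" "a' \<bullet> b' = c\<^sup>2 * (a \<bullet> b)" "b' \<bullet> b' = c\<^sup>2 * (b \<bullet> b)"
    using similar_lattices_gram[OF basis L'(3,1)] by metis
  have "a' \<in> L'" "b' \<in> L'"
    using basis' generators_in_lattice_gen by (auto simp: lattice_basis_def)
  then have "a' \<bullet> a' \<in> \<int>" "a' \<bullet> b' \<in> \<int>" "b' \<bullet> b' \<in> \<int>"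
    using L'(2) by (auto simp: integral_lattice_def)
  then obtain A B C where ABC: "a' \<bullet> a' = of_int A" "a' \<bullet> b' = of_int B" "b' \<bullet> b' = of_int C"
    by (metis Ints_cases)
  define \<nu> where "\<nu> = lattice_nu L'"
  obtain \<kappa> :: int where sf: "squarefree \<nu>" and \<kappa>: "(lattice_area L')\<^sup>2 = (of_int \<kappa>)\<^sup>2 * of_nat \<nu>"
    using lattice_nu[OF L'(1,2)] by (auto simp: \<nu>_def)
  have "real_of_int (A * C - B\<^sup>2) = of_int (\<kappa>\<^sup>2 * int \<nu>)"
    using lattice_area_gram[OF basis'] \<kappa> unfolding ABC by simp
  then have disc: "A * C - B\<^sup>2 = \<kappa>\<^sup>2 * int \<nu>" by (simp only: of_int_eq_iff)
  have \<nu>_mod: "\<nu> mod 4 = 3" using mod4 by (simp add: cong_def \<nu>_def)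
  then have \<nu>: "0 < \<nu>" "\<nu> \<noteq> 1" "odd \<nu>" by (auto intro!: gr0I) presburger
  have le: "p \<le> n" if "p \<in> prime_factors \<nu>" for p
  proof -
    have "p \<le> Max (prime_factors \<nu>)" using that by (intro Max_ge) auto
    then show ?thesis using max by (simp add: \<nu>_def)
  qed
  have odd: "odd p" if "p \<in> prime_factors \<nu>" for p
    using that \<nu>(3) by (auto simp: prime_factors_dvd dest: dvd_trans)
  have S: "prime_factors \<nu> \<subseteq> {3, 5, 7, 11, 13}"
  proof
    fix p assume p: "p \<in> prime_factors \<nu>"
    then show "p \<in> {3, 5, 7, 11, 13}"
      using le[OF p] odd[OF p] n(3) by (intro odd_prime_less_17) auto
  qed
  have "prime_factors \<nu> \<noteq> {}" using \<nu> by (simp add: prime_factorization_empty_iff)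
  then have "Max (prime_factors \<nu>) \<in> prime_factors \<nu>" by (intro Max_in) auto
  then have "odd (Max (prime_factors \<nu>))" by (rule odd)
  moreover have "unit_config \<nu> (Max (prime_factors \<nu>))"
    using S sf mod4 by (intro unit_config_cases) (simp_all add: \<nu>_def)
  ultimately have "unit_config \<nu> k"
    using unit_config_mono \<nu>(1) max k by (metis \<nu>_def order.trans)
  then show ?thesis
    using convex_equilateral_gon_of_unit_config[OF basis c _ _ _ disc \<nu>(1)] ABC gram n k by simp
qed

theorem theorem3p5:
  fixes n :: nat and L :: "(real^2) set"
  assumes "odd n" and "3 \<le> n" and "n < 17"
    and "planar_lattice L"
  shows "(contains_equilateral_gon L n \<longleftrightarrow> (\<forall>k\<ge>n. contains_convex_equilateral_gon L k)) \<and>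
    ((\<forall>k\<ge>n. contains_convex_equilateral_gon L k) \<longleftrightarrow>
      (\<exists>L'. planar_lattice L' \<and> integral_lattice L' \<and> similar_lattices L L' \<and>
        [lattice_nu L' = 3] (mod 4) \<and> Max (prime_factors (lattice_nu L')) \<le> n))"
proof -
  obtain a b where basis: "lattice_basis a b L" using assms(4) by (auto simp: planar_lattice_def)
  have "contains_equilateral_gon L n" if "\<forall>k\<ge>n. contains_convex_equilateral_gon L k"
    using that unfolding contains_convex_equilateral_gon_def contains_equilateral_gon_def convex_polygon_def
    by blast
  then show ?thesis
    using integral_lattice_of_equilateral_gon[OF basis assms(1)]
      convex_gons_of_similar_integral_lattice[OF basis assms(1-3)]
    by blast
qed

end
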